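(* Let $\mathcal{H}$ be a complex Hilbert space and $n\geq 2$. Let $M:\Delta_{n}\times B(\mathcal{H})_{+}^{n}\to B(\mathcal{H})_{+}$ satisfy, for all $\omega=(w_1,\dots,w_n)\in\Delta_n$ and $\mathbb{A}=(A_1,\dots,A_n)\in B(\mathcal{H})_+^n$: (P3) $M(w_{\pi(1)},\dots,w_{\pi(n)};A_{\pi(1)},\dots,A_{\pi(n)})=M(\omega;\mathbb{A})$ for every permutation $\pi$ of $\{1,\dots,n\}$; (P7) $M(\omega;X^{*}A_{1}X,\dots,X^{*}A_{n}X)=X^{*}M(\omega;\mathbb{A})X$ for every invertible $X\in B(\mathcal{H})$; (P8) $M(\omega;A_1^{-1},\dots,A_n^{-1})^{-1}=M(\omega;\mathbb{A})$; (P10) $\left[\sum_{i=1}^{n}w_{i}A_{i}^{-1}\right]^{-1}\leq M(\omega;\mathbb{A})\leq\sum_{i=1}^{n}w_{i}A_{i}$. Suppose that the $M$-logarithmic mean $$\mathfrak{L}(M)(\mathbb{A})=(n-1)!\int_{\Delta_{n}}M(\omega;\mathbb{A})\,d\omega$$ exists for every $\mathbb{A}\in B(\mathcal{H})_+^n$. Then for all $\mathbb{A}=(A_1,\dots,A_n)\in B(\mathcal{H})_{+}^{n}$: (i) $\mathfrak{L}(M)(A_{\pi(1)},\dots,A_{\pi(n)})=\mathfrak{L}(M)(\mathbb{A})$ for every permutation $\pi$ of $\{1,\dots,n\}$; (ii) $\mathfrak{L}(M)(X^{*}A_{1}X,\dots,X^{*}A_{n}X)=X^{*}\,\mathfrak{L}(M)(\mathbb{A})\,X$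 for every invertible $X\in B(\mathcal{H})$; (iii) $\mathfrak{H}(\mathbb{A})\leq\mathfrak{L}(M)(\mathbb{A})\leq\mathfrak{A}(\mathbb{A})$.
   Context: $B(\mathcal{H})$ is the algebra of bounded linear operators on $\mathcal{H}$ and $B(\mathcal{H})_{+}$ is the set of positive definite (positive and invertible) operators. For self-adjoint $A,B$, $A\leq B$ means $B-A$ is positive semi-definite. $\Delta_{n}$ is the set of $\omega=(w_1,\dots,w_n)\in(0,1)^n$ with $\sum_k w_k=1$. The measure $d\omega$ is Lebesgue measure on $\Delta_n$ in the coordinates $(w_1,\dots,w_{n-1})$, so that $(n-1)!\,d\omega$ is the uniform probability measure on $\Delta_n$. The integral is the $B(\mathcal{H})$-valued (Bochner) integral, and "exists" means that $\omega\mapsto M(\omega;\mathbb{A})$ is integrable. $\mathfrak{A}(\mathbb{A})=\frac1n\sum_{i=1}^{n}A_i$ and $\mathfrak{H}(\mathbb{A})=\left(\frac1n\sum_{i=1}^{n}A_i^{-1}\right)^{-1}$. *)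

theory Defs
  imports "HOL-Analysis.Analysis"
begin

section \<open>Complex Hilbert spaces\<close>

text \<open>The underlying real structure (norm, topology, completeness) comes from
  \<^class>\<open>real_inner\<close> and \<^class>\<open>complete_space\<close>; the axioms \<open>scaleR_scaleC\<close> and
  \<open>inner_eq_Re_cinner\<close> tie the complex structure to it, so that \<open>\<parallel>x\<parallel>\<^sup>2 = \<langle>x, x\<rangle>\<close>. The form is linear in its first argument.\<close>

class chilbert_space = real_inner + complete_space +
  fixes scaleC :: "complex \<Rightarrow> 'a \<Rightarrow> 'a" (infixr \<open>*\<^sub>C\<close> 75)
    and cinner :: "'a \<Rightarrow> 'a \<Rightarrow> complex"
  assumes scaleC_add_right: "c *\<^sub>C (x + y) = c *\<^sub>C x + c *\<^sub>C y"
    and scaleC_add_left: "(c + d) *\<^sub>C x = c *\<^sub>C x + d *\<^sub>C x"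
    and scaleC_scaleC: "c *\<^sub>C d *\<^sub>C x = (c * d) *\<^sub>C x"
    and scaleR_scaleC: "r *\<^sub>R x = complex_of_real r *\<^sub>C x"
    and cinner_commute: "cinner x y = cnj (cinner y x)"
    and cinner_add_left: "cinner (x + y) z = cinner x z + cinner y z"
    and cinner_scaleC_left: "cinner (c *\<^sub>C x) y = c * cinner x y"
    and inner_eq_Re_cinner: "inner x y = Re (cinner x y)"
begin

subclass banach ..

lemma scaleC_minus_right: "c *\<^sub>C (- x) = - (c *\<^sub>C x)"
proof -
  have "c *\<^sub>C (0 + 0) = c *\<^sub>C 0 + c *\<^sub>C 0" by (rule scaleC_add_right)
  then have "c *\<^sub>C 0 = 0" by simp
  then show ?thesis
    using scaleC_add_right[of c x "- x"] by (simp add: eq_neg_iff_add_eq_0 add.commute)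
qed

lemma scaleC_diff_right: "c *\<^sub>C (x - y) = c *\<^sub>C x - c *\<^sub>C y"
  using scaleC_add_right[of c x "- y"] by (simp add: scaleC_minus_right)

lemma scaleC_zero_right: "c *\<^sub>C 0 = 0"
  using scaleC_diff_right[of c 0 0] by simp

lemma scaleC_scaleR_commute: "c *\<^sub>C (r *\<^sub>R x) = r *\<^sub>R (c *\<^sub>C x)"
  by (simp add: scaleR_scaleC scaleC_scaleC mult.commute)

end

lemma norm_scaleC: "norm (c *\<^sub>C x) = cmod c * norm (x :: 'a :: chilbert_space)"
proof -
  have *: "cinner x (c *\<^sub>C x) = cnj c * cinner x x"
    by (metis cinner_commute cinner_scaleC_left complex_cnj_mult)
  have "inner (c *\<^sub>C x) (c *\<^sub>C x) = (cmod c)\<^sup>2 * inner x x"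
    unfolding inner_eq_Re_cinner cinner_scaleC_left * cmod_power2
    by (simp add: algebra_simps power2_eq_square)
  then show ?thesis
    by (simp add: norm_eq_sqrt_inner real_sqrt_mult)
qed

section \<open>The Banach algebra of bounded complex-linear operators\<close>

typedef (overloaded) 'a bop =
  "{T :: 'a::chilbert_space \<Rightarrow>\<^sub>L 'a. \<forall>c x. blinfun_apply T (c *\<^sub>C x) = c *\<^sub>C blinfun_apply T x}"
  morphisms blinfun_of_bop Abs_bop
  by (rule exI[of _ 0]) (simp add: scaleC_zero_right)

setup_lifting type_definition_bop

lift_definition bop_apply :: "'a::chilbert_space bop \<Rightarrow> 'a \<Rightarrow> 'a" is blinfun_apply .

instantiation bop :: (chilbert_space) "{real_normed_algebra, monoid_mult}"
begin

lift_definition zero_bop :: "'a bop" is 0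
  by (simp add: scaleC_zero_right)

lift_definition one_bop :: "'a bop" is id_blinfun
  by simp

lift_definition plus_bop :: "'a bop \<Rightarrow> 'a bop \<Rightarrow> 'a bop" is "(+)"
  by (simp add: blinfun.add_left scaleC_add_right)

lift_definition minus_bop :: "'a bop \<Rightarrow> 'a bop \<Rightarrow> 'a bop" is "(-)"
  by (simp add: blinfun.diff_left scaleC_diff_right)

lift_definition uminus_bop :: "'a bop \<Rightarrow> 'a bop" is uminus
  by (simp add: blinfun.minus_left scaleC_minus_right)

lift_definition times_bop :: "'a bop \<Rightarrow> 'a bop \<Rightarrow> 'a bop" is "(o\<^sub>L)"
  by simp

lift_definition scaleR_bop :: "real \<Rightarrow> 'a bop \<Rightarrow> 'a bop" is scaleR
  by (simp add: blinfun.scaleR_left scaleC_scaleR_commute)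

lift_definition norm_bop :: "'a bop \<Rightarrow> real" is norm .

definition dist_bop :: "'a bop \<Rightarrow> 'a bop \<Rightarrow> real"
  where "dist_bop A B = norm (A - B)"

definition sgn_bop :: "'a bop \<Rightarrow> 'a bop"
  where "sgn_bop A = scaleR (inverse (norm A)) A"

definition [code del]:
  "(uniformity :: ('a bop \<times> 'a bop) filter) = (INF e\<in>{0 <..}. principal {(x, y). dist x y < e})"

definition open_bop :: "'a bop set \<Rightarrow> bool"
  where [code del]: "open_bop S = (\<forall>x\<in>S. \<forall>\<^sub>F (x', y) in uniformity. x' = x \<longrightarrow> y \<in> S)"

instance
  apply standard
  unfolding dist_bop_def open_bop_def sgn_bop_def uniformity_bop_def
  apply (rule refl | (transfer, force simp: algebra_simps norm_triangle_ineq
      norm_blinfun_compose blinfun.bilinear_simps intro!: blinfun_eqI))+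
  done

end

instance bop :: (chilbert_space) banach
proof
  fix X :: "nat \<Rightarrow> 'a bop"
  assume "Cauchy X"
  then have "Cauchy (\<lambda>n. blinfun_of_bop (X n))"
    unfolding Cauchy_def dist_norm
    by (simp add: norm_bop.rep_eq minus_bop.rep_eq)
  then obtain T where T: "(\<lambda>n. blinfun_of_bop (X n)) \<longlonglongrightarrow> T"
    using convergent_eq_Cauchy by blast
  have "blinfun_apply T (c *\<^sub>C x) = c *\<^sub>C blinfun_apply T x" for c x
  proof -
    have bl: "bounded_linear ((*\<^sub>C) c :: 'a \<Rightarrow> 'a)"
      by (rule bounded_linear_intro[where K = "cmod c"])
        (simp_all add: scaleC_add_right scaleC_scaleR_commute norm_scaleC)
    have ap: "(\<lambda>n. blinfun_apply (blinfun_of_bop (X n)) y) \<longlonglongrightarrow> blinfun_apply T y" for y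
      by (intro tendsto_intros T)
    have "(\<lambda>n. c *\<^sub>C blinfun_apply (blinfun_of_bop (X n)) x) \<longlonglongrightarrow> c *\<^sub>C blinfun_apply T x"
      by (rule bounded_linear.tendsto[OF bl ap])
    moreover have "c *\<^sub>C blinfun_apply (blinfun_of_bop (X n)) x
        = blinfun_apply (blinfun_of_bop (X n)) (c *\<^sub>C x)" for n
      using blinfun_of_bop[of "X n"] by simp
    ultimately show ?thesis
      using ap[of "c *\<^sub>C x"] LIMSEQ_unique by simp
  qed
  then have "blinfun_of_bop (Abs_bop T) = T"
    by (simp add: Abs_bop_inverse)
  with T have "X \<longlonglongrightarrow> Abs_bop T"
    unfolding LIMSEQ_def dist_norm
    by (simp add: norm_bop.rep_eq minus_bop.rep_eq)
  then show "convergent X"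
    by (auto simp: convergent_def)
qed

section \<open>Inverses, adjoints and the order\<close>

definition bop_invertible :: "'a::chilbert_space bop \<Rightarrow> bool" where
  "bop_invertible A \<longleftrightarrow> (\<exists>B. A * B = 1 \<and> B * A = 1)"

definition bop_inv :: "'a::chilbert_space bop \<Rightarrow> 'a bop" where
  "bop_inv A = (THE B. A * B = 1 \<and> B * A = 1)"

text \<open>Existence of the adjoint is the Riesz representation theorem.\<close>

definition bop_adj :: "'a::chilbert_space bop \<Rightarrow> 'a bop" where
  "bop_adj A = (THE B. \<forall>x y. cinner (bop_apply A x) y = cinner x (bop_apply B y))"

text \<open>Over the complex numbers \<open>\<langle>Ax, x\<rangle> \<in> \<real>\<close> for all \<open>x\<close> already forces \<open>A\<close> to be self-adjoint.\<close>

definition bop_psd :: "'a::chilbert_space bop \<Rightarrow> bool" where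
  "bop_psd A \<longleftrightarrow> (\<forall>x. cinner (bop_apply A x) x \<in> \<real> \<and> 0 \<le> Re (cinner (bop_apply A x) x))"

definition bop_le :: "'a::chilbert_space bop \<Rightarrow> 'a bop \<Rightarrow> bool" (infix \<open>\<preceq>\<close> 50) where
  "A \<preceq> B \<longleftrightarrow> bop_psd (B - A)"

definition bop_pos :: "'a::chilbert_space bop set" where
  "bop_pos = {A. bop_psd A \<and> bop_invertible A}"

section \<open>The Bochner integral\<close>

text \<open>The library's \<^const>\<open>has_bochner_integral\<close> requires a second countable target space, which
  the operator algebra is not. For a general Banach space, Borel measurability has to be replaced
  by strong measurability: the integrand is an almost everywhere limit of simple functions.\<close>

definition has_bochner_int :: "'s measure \<Rightarrow> ('s \<Rightarrow> 'b::banach) \<Rightarrow> 'b \<Rightarrow> bool" where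
  "has_bochner_int \<mu> f I \<longleftrightarrow>
    (\<exists>s. (\<forall>k. Bochner_Integration.simple_bochner_integrable \<mu> (s k)) \<and>
         (AE \<omega> in \<mu>. (\<lambda>k. s k \<omega>) \<longlonglongrightarrow> f \<omega>) \<and>
         (\<lambda>k. \<integral>\<^sup>+ \<omega>. ennreal (norm (f \<omega> - s k \<omega>)) \<partial>\<mu>) \<longlonglongrightarrow> 0 \<and>
         (\<lambda>k. Bochner_Integration.simple_bochner_integral \<mu> (s k)) \<longlonglongrightarrow> I)"

definition bochner_integrable :: "'s measure \<Rightarrow> ('s \<Rightarrow> 'b::banach) \<Rightarrow> bool" where
  "bochner_integrable \<mu> f \<longleftrightarrow> (\<exists>I. has_bochner_int \<mu> f I)"

definition bochner_integral :: "'s measure \<Rightarrow> ('s \<Rightarrow> 'b::banach) \<Rightarrow> 'b" where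
  "bochner_integral \<mu> f = (THE I. has_bochner_int \<mu> f I)"

section \<open>The simplex, tuples and means\<close>

text \<open>An \<open>n\<close>-tuple is a function on \<open>{1..n}\<close>, extended by \<^const>\<open>undefined\<close> outside, so that
  equality of functions is equality of tuples.\<close>

definition simplex_weights :: "nat \<Rightarrow> (nat \<Rightarrow> real) set" where
  "simplex_weights n = {w \<in> {1..n} \<rightarrow>\<^sub>E {0<..<1}. (\<Sum>k=1..n. w k) = 1}"

definition pos_tuples :: "nat \<Rightarrow> (nat \<Rightarrow> 'a::chilbert_space bop) set" where
  "pos_tuples n = {1..n} \<rightarrow>\<^sub>E bop_pos"

definition permute_tuple :: "nat \<Rightarrow> (nat \<Rightarrow> nat) \<Rightarrow> (nat \<Rightarrow> 'b) \<Rightarrow> nat \<Rightarrow> 'b" where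
  "permute_tuple n \<pi> v = (\<lambda>i\<in>{1..n}. v (\<pi> i))"

definition weights_of_coords :: "nat \<Rightarrow> (nat \<Rightarrow> real) \<Rightarrow> nat \<Rightarrow> real" where
  "weights_of_coords n x = x(n := 1 - (\<Sum>i\<in>{1..<n}. x i))"

text \<open>Lebesgue measure on the simplex in the coordinates \<open>(w\<^sub>1, \<dots>, w\<^bsub>n-1\<^esub>)\<close>: the restriction of
  \<open>(n-1)\<close>-dimensional Lebesgue measure to the coordinate domain of the simplex, transported to the
  simplex itself.\<close>

definition simplex_measure :: "nat \<Rightarrow> (nat \<Rightarrow> real) measure" where
  "simplex_measure n =
    embed_measure
      (restrict_space (completion (\<Pi>\<^sub>M i\<in>{1..<n}. lborel))
        {x \<in> {1..<n} \<rightarrow>\<^sub>E UNIV. weights_of_coords n x \<in> simplex_weights n})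
      (weights_of_coords n)"

definition arith_mean :: "nat \<Rightarrow> (nat \<Rightarrow> 'a::chilbert_space bop) \<Rightarrow> 'a bop" where
  "arith_mean n A = (1 / real n) *\<^sub>R (\<Sum>i=1..n. A i)"

definition harm_mean :: "nat \<Rightarrow> (nat \<Rightarrow> 'a::chilbert_space bop) \<Rightarrow> 'a bop" where
  "harm_mean n A = bop_inv ((1 / real n) *\<^sub>R (\<Sum>i=1..n. bop_inv (A i)))"

definition log_mean_exists ::
  "nat \<Rightarrow> ((nat \<Rightarrow> real) \<Rightarrow> (nat \<Rightarrow> 'a bop) \<Rightarrow> 'a::chilbert_space bop) \<Rightarrow> (nat \<Rightarrow> 'a bop) \<Rightarrow> bool"
  where "log_mean_exists n M A \<longleftrightarrow> bochner_integrable (simplex_measure n) (\<lambda>\<omega>. M \<omega> A)"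

definition log_mean ::
  "nat \<Rightarrow> ((nat \<Rightarrow> real) \<Rightarrow> (nat \<Rightarrow> 'a bop) \<Rightarrow> 'a::chilbert_space bop) \<Rightarrow> (nat \<Rightarrow> 'a bop) \<Rightarrow> 'a bop"
  where "log_mean n M A = fact (n - 1) *\<^sub>R bochner_integral (simplex_measure n) (\<lambda>\<omega>. M \<omega> A)"

end

theory Submission
  imports Defs
begin

text \<open>Congruence by \<open>X\<close> is bounded and linear, hence commutes with the integral. The other
  claims are tested against real continuous linear functionals, which turn the operator-valued integral into a Lebesgue integral in the coordinates \<open>(w\<^sub>1, \<dots>, w\<^bsub>n-1\<^esub>)\<close>.
  There the transposition of the weights \<open>w\<^sub>a\<close> and \<open>w\<^sub>n\<close> is the map \<open>w\<^sub>a \<mapsto> 1 - (w\<^sub>1 + \<dots> + w\<^bsub>n-1\<^esub>)\<close>,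
  a reflection in one coordinate, hence measure preserving; such transpositions generate all
  permutations. By this symmetry every weight has mean \<open>1/n\<close>, which gives the upper bound.
  For the lower bound put \<open>B = \<Sum> w\<^sub>i A\<^sub>i\<^sup>-\<^sup>1\<close> and use \<open>\<langle>B\<^sup>-\<^sup>1 x, x\<rangle> \<ge> 2 Re \<langle>x, y\<rangle> - \<langle>B y, y\<rangle>\<close>:
  the right-hand side is affine in the weights, and after integration the choice
  \<open>y = H x\<close>, with \<open>H\<close> the harmonic mean, makes it equal to \<open>\<langle>H x, x\<rangle>\<close>.\<close>

section \<open>Positive operators\<close>

lemma bop_apply_one [simp]: "bop_apply 1 x = x"
  and bop_apply_add: "bop_apply (S + T) x = bop_apply S x + bop_apply T x"
  and bop_apply_diff: "bop_apply (S - T) x = bop_apply S x - bop_apply T x"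
  and bop_apply_scaleR: "bop_apply (r *\<^sub>R T) x = r *\<^sub>R bop_apply T x"
  and bop_apply_times [simp]: "bop_apply (S * T) x = bop_apply S (bop_apply T x)"
  by (transfer; simp add: blinfun.bilinear_simps)+

lemma bop_apply_scaleC: "bop_apply T (c *\<^sub>C x) = c *\<^sub>C bop_apply T x"
  by transfer simp

lemma bop_eqI: "(\<And>x. bop_apply S x = bop_apply T x) \<Longrightarrow> S = T"
  by transfer (rule blinfun_eqI)

lemma norm_bop_apply: "norm (bop_apply T x) \<le> norm T * norm x"
  by transfer (rule norm_blinfun)

lemma norm_bop_bound:
  "0 \<le> b \<Longrightarrow> (\<And>x. norm (bop_apply T x) \<le> b * norm x) \<Longrightarrow> norm T \<le> b"
  by transfer (rule norm_blinfun_bound)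

lemma bounded_linear_bop_apply: "bounded_linear (bop_apply T)"
  by transfer (rule blinfun.bounded_linear_right)

lemma bounded_linear_bop_eval: "bounded_linear (\<lambda>T. bop_apply T x)"
  by (rule bounded_linear_intro[where K = "norm x"])
    (simp_all add: bop_apply_add bop_apply_scaleR norm_bop_apply)

lemmas linear_bop_apply = bounded_linear.linear[OF bounded_linear_bop_apply]
lemmas bop_apply_add_right = linear_add[OF linear_bop_apply]
  and bop_apply_diff_right = linear_diff[OF linear_bop_apply]
  and bop_apply_scaleR_right = linear_scale[OF linear_bop_apply]

lemma bounded_linear_scaleC: "bounded_linear ((*\<^sub>C) c :: 'a \<Rightarrow> 'a::chilbert_space)"
  by (rule bounded_linear_intro[where K = "cmod c"])
    (simp_all add: scaleC_add_right scaleC_scaleR_commute norm_scaleC)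

text \<open>With \<open>c = - \<i>\<close> and \<open>y = x\<close> this functional is the imaginary
  part of the quadratic form, so that the reality of the form survives integration.\<close>

lemma bounded_linear_bop_form: "bounded_linear (\<lambda>T. inner (c *\<^sub>C bop_apply T x) y)"
  by (intro bounded_linear_inner_left_comp bounded_linear_compose[OF bounded_linear_scaleC]
      bounded_linear_bop_eval)

lemma bounded_linear_bop_inner: "bounded_linear (\<lambda>T. inner (bop_apply T x) y)"
  by (intro bounded_linear_inner_left_comp bounded_linear_bop_eval)

lemma cinner_add_right: "cinner x (y + z) = cinner x y + cinner x (z :: 'a::chilbert_space)"
  by (metis cinner_add_left cinner_commute complex_cnj_add)

lemma cinner_scaleC_right: "cinner x (c *\<^sub>C y) = cnj c * cinner x (y :: 'a::chilbert_space)"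
  by (metis cinner_commute cinner_scaleC_left complex_cnj_mult)

lemma Im_cinner: "Im (cinner x y) = inner ((- \<i>) *\<^sub>C x) (y :: 'a::chilbert_space)"
  by (simp add: inner_eq_Re_cinner cinner_scaleC_left)

text \<open>In this form positivity is a condition on real continuous linear functionals of the operator,
  which pass under the integral sign.\<close>

lemma bop_psd_iff_functionals:
  "bop_psd T \<longleftrightarrow> (\<forall>x. inner ((- \<i>) *\<^sub>C bop_apply T x) x = 0 \<and> 0 \<le> inner (bop_apply T x) x)"
  unfolding bop_psd_def complex_is_Real_iff Im_cinner[symmetric]
  unfolding inner_eq_Re_cinner ..

lemma bop_psd_nonneg: "bop_psd T \<Longrightarrow> 0 \<le> inner (bop_apply T x) x"
  by (simp add: bop_psd_iff_functionals)

text \<open>Polarization: reality of the form at \<open>x + y\<close> gives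
  \<open>Im (a + b) = 0\<close>, and reality at \<open>x + \<i> *\<^sub>C y\<close> gives
  \<open>Re a = Re b\<close>, so \<open>a\<close> and \<open>b\<close> are conjugate.\<close>

lemma bop_psd_cinner_symmetric:
  assumes "bop_psd T"
  shows "cinner (bop_apply T x) y = cinner x (bop_apply T y)"
proof -
  define a where "a = cinner (bop_apply T x) y"
  define b where "b = cinner (bop_apply T y) x"
  have real: "Im (cinner (bop_apply T z) z) = 0" for z
    using assms by (simp add: bop_psd_def complex_is_Real_iff)
  have "Im (a + b) = 0"
    using real[of "x + y"] real[of x] real[of y]
    by (simp add: a_def b_def bop_apply_add_right cinner_add_left cinner_add_right)
  moreover have "Re a = Re b"
    using real[of "x + \<i> *\<^sub>C y"] real[of x] real[of y]
    by (simp add: a_def b_def bop_apply_add_right cinner_add_left cinner_add_right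
        bop_apply_scaleC cinner_scaleC_left cinner_scaleC_right)
  ultimately have "a = cnj b"
    by (simp add: complex_eq_iff)
  then show ?thesis
    unfolding a_def b_def by (metis cinner_commute)
qed

lemma bop_psd_symmetric:
  "bop_psd T \<Longrightarrow> inner (bop_apply T x) y = inner x (bop_apply T y)"
  by (simp add: inner_eq_Re_cinner bop_psd_cinner_symmetric)

lemma bop_psd_inner_diff:
  assumes "bop_psd T"
  shows "inner (bop_apply T (x - y)) (x - y)
    = inner (bop_apply T x) x - 2 * inner (bop_apply T x) y + inner (bop_apply T y) y"
  using bop_psd_symmetric[OF assms, of y x]
  by (simp add: bop_apply_diff_right inner_diff_left inner_diff_right inner_commute)

lemma bop_psd_one: "bop_psd (1 :: 'a::chilbert_space bop)"
proof -
  have "cinner x x \<in> \<real>" "0 \<le> Re (cinner x x)" for x :: 'a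
    using cinner_commute[of x x] inner_ge_zero[of x]
    by (simp_all only: Reals_cnj_iff inner_eq_Re_cinner)
  then show ?thesis
    by (simp add: bop_psd_def)
qed

lemma bop_psd_scaleR: "bop_psd T \<Longrightarrow> 0 \<le> r \<Longrightarrow> bop_psd (r *\<^sub>R T)"
  by (simp add: bop_psd_iff_functionals bop_apply_scaleR scaleC_scaleR_commute)

lemma bop_psd_sum: "(\<And>i. i \<in> I \<Longrightarrow> bop_psd (T i)) \<Longrightarrow> bop_psd (\<Sum>i\<in>I. T i)"
  by (simp add: bop_psd_iff_functionals
      linear_sum[OF bounded_linear.linear[OF bounded_linear_bop_form]]
      linear_sum[OF bounded_linear.linear[OF bounded_linear_bop_inner]] sum_nonneg)

section \<open>Norm bounds, coercivity and invertibility\<close>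

lemma bop_psd_norm_square_le:
  assumes T: "bop_psd T"
  shows "(norm (bop_apply T x))\<^sup>2 \<le> norm T * inner (bop_apply T x) x"
proof (cases "norm T = 0")
  case True
  then show ?thesis
    using norm_bop_apply[of T x] by simp
next
  case False
  then have pos: "norm T > 0" by simp
  let ?y = "bop_apply T x"
  \<comment> \<open>The form is tested at \<open>x - s *\<^sub>R ?y\<close>. With this
    \<open>s\<close> its quadratic term is at most \<open>s * (norm ?y)\<^sup>2\<close>, half of
    what the cross term subtracts.\<close>
  define s where "s = 1 / norm T"
  have "inner (bop_apply T ?y) ?y \<le> norm (bop_apply T ?y) * norm ?y"
    by (rule norm_cauchy_schwarz)
  also have "\<dots> \<le> norm T * norm ?y * norm ?y"
    by (intro mult_right_mono norm_bop_apply norm_ge_zero)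
  finally have le: "s\<^sup>2 * inner (bop_apply T ?y) ?y \<le> s * (norm ?y)\<^sup>2"
    using pos by (simp add: s_def field_simps power2_eq_square)
  have "0 \<le> inner (bop_apply T (x - s *\<^sub>R ?y)) (x - s *\<^sub>R ?y)"
    by (rule bop_psd_nonneg[OF T])
  also have "\<dots> = inner ?y x - 2 * s * (norm ?y)\<^sup>2 + s\<^sup>2 * inner (bop_apply T ?y) ?y"
    by (simp add: bop_psd_inner_diff[OF T] bop_apply_scaleR_right power2_norm_eq_inner
        power2_eq_square[of s])
  finally have "s * (norm ?y)\<^sup>2 \<le> inner ?y x"
    using le by simp
  then show ?thesis
    using pos by (simp add: s_def field_simps)
qed

text \<open>A left inverse \<open>S\<close> bounds \<open>norm x\<close> by
  \<open>norm S * norm (bop_apply T x)\<close>, and the preceding inequality bounds the latter norm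
  by the form.\<close>

lemma bop_pos_coercive:
  assumes "T \<in> bop_pos"
  obtains c where "c > 0" "\<And>x. c * (norm x)\<^sup>2 \<le> inner (bop_apply T x) x"
proof -
  from assms obtain S where T: "bop_psd T" and S: "S * T = 1"
    by (auto simp: bop_pos_def bop_invertible_def)
  \<comment> \<open>The summand 1 keeps \<open>K\<close> positive on the zero space, where both
    norms vanish.\<close>
  define K where "K = (norm S)\<^sup>2 * norm T + 1"
  have K: "K > 0"
    unfolding K_def by (intro add_nonneg_pos mult_nonneg_nonneg) auto
  have "(norm x)\<^sup>2 \<le> K * inner (bop_apply T x) x" for x
  proof -
    have "bop_apply S (bop_apply T x) = x"
      using S by (metis bop_apply_one bop_apply_times)
    then have "norm x \<le> norm S * norm (bop_apply T x)"
      using norm_bop_apply[of S "bop_apply T x"] by simp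
    then have "(norm x)\<^sup>2 \<le> (norm S)\<^sup>2 * (norm (bop_apply T x))\<^sup>2"
      using power_mono[OF _ norm_ge_zero, of x _ 2] by (metis power_mult_distrib)
    also have "\<dots> \<le> (norm S)\<^sup>2 * (norm T * inner (bop_apply T x) x)"
      by (intro mult_left_mono bop_psd_norm_square_le[OF T]) simp
    also have "\<dots> \<le> K * inner (bop_apply T x) x"
      using bop_psd_nonneg[OF T, of x] by (simp add: K_def algebra_simps)
    finally show ?thesis .
  qed
  then show thesis
    using K that[of "1 / K"] by (simp add: field_simps)
qed

text \<open>Neumann series: multiplying the sum of the powers of \<open>S\<close> by
  \<open>S\<close> on either side removes its first term, so the sum is a two-sided inverse.\<close>

lemma bop_invertible_one_minus:
  fixes S :: "'a::chilbert_space bop"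
  assumes "norm S < 1"
  shows "bop_invertible (1 - S)"
proof -
  \<comment> \<open>The identity has norm 0 on the zero space, so \<open>norm 1\<close> is carried
    along as a constant.\<close>
  have bound: "norm (S ^ k) \<le> norm (1 :: 'a bop) * norm S ^ k" for k
  proof (induction k)
    case (Suc k)
    have "norm (S ^ Suc k) \<le> norm S * norm (S ^ k)"
      by (simp add: norm_mult_ineq)
    also have "\<dots> \<le> norm S * (norm (1 :: 'a bop) * norm S ^ k)"
      using Suc by (intro mult_left_mono) auto
    finally show ?case by (simp add: mult_ac)
  qed simp
  have sm: "summable (\<lambda>k. S ^ k)"
  proof (rule summable_comparison_test'[OF _ bound])
    show "summable (\<lambda>k. norm (1 :: 'a bop) * norm S ^ k)"
      using assms by (intro summable_mult summable_geometric) simp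
  qed
  let ?B = "\<Sum>k. S ^ k"
  have tail: "(\<Sum>k. S ^ Suc k) = ?B - 1"
    using suminf_split_head[OF sm] by (simp only: power_0)
  have "S * ?B = ?B - 1"
    using bounded_linear.suminf[OF bounded_linear_mult_right sm, of S] tail by (simp only: power_Suc)
  moreover have "?B * S = ?B - 1"
    using bounded_linear.suminf[OF bounded_linear_mult_left sm, of S] tail
    by (simp only: power_Suc2)
  ultimately have "(1 - S) * ?B = 1 \<and> ?B * (1 - S) = 1"
    by (simp add: left_diff_distrib right_diff_distrib)
  then show ?thesis
    unfolding bop_invertible_def by blast
qed

lemma bop_invertible_scaleR:
  assumes "bop_invertible T" "r \<noteq> 0"
  shows "bop_invertible (r *\<^sub>R T)"
proof -
  from assms(1) obtain S where "T * S = 1" "S * T = 1"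
    by (auto simp: bop_invertible_def)
  with assms(2) show ?thesis
    unfolding bop_invertible_def by (intro exI[of _ "(1 / r) *\<^sub>R S"]) simp
qed

text \<open>With \<open>K\<close> exceeding the norm of \<open>T\<close>, the operator \<open>1 - T / K\<close> is positive and has norm at most
  \<open>1 - c / K\<close>, so that the Neumann series inverts \<open>T / K\<close>.\<close>

lemma bop_pos_if_coercive:
  assumes T: "bop_psd T" and c: "c > 0"
    and coercive: "\<And>x. c * (norm x)\<^sup>2 \<le> inner (bop_apply T x) x"
  shows "T \<in> bop_pos"
proof -
  \<comment> \<open>Adding \<open>c\<close> to the norm ensures \<open>c \<le> K\<close>, so that
    \<open>q\<close> below is nonnegative.\<close>
  define K where "K = norm T + c"
  have K: "K > 0" "c \<le> K"
    using c by (auto simp: K_def add_nonneg_pos)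
  define S where "S = 1 - (1 / K) *\<^sub>R T"
  have S_form: "inner (bop_apply S x) x = (norm x)\<^sup>2 - inner (bop_apply T x) x / K" for x
    by (simp add: S_def bop_apply_diff bop_apply_scaleR inner_diff_left power2_norm_eq_inner)
  have "inner (bop_apply T x) x \<le> K * (norm x)\<^sup>2" for x
  proof -
    have "inner (bop_apply T x) x \<le> norm (bop_apply T x) * norm x"
      by (rule norm_cauchy_schwarz)
    also have "\<dots> \<le> norm T * norm x * norm x"
      by (intro mult_right_mono norm_bop_apply norm_ge_zero)
    also have "\<dots> \<le> K * norm x * norm x"
      using c by (intro mult_right_mono) (auto simp: K_def)
    finally show ?thesis by (simp add: power2_eq_square mult.assoc)
  qed
  then have S_nonneg: "0 \<le> inner (bop_apply S x) x" for x
    using K by (simp add: S_form field_simps)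
  have S: "bop_psd S"
    using S_nonneg T bop_psd_one
    by (simp add: bop_psd_iff_functionals S_def bop_apply_diff bop_apply_scaleR
        scaleC_diff_right scaleC_scaleR_commute inner_diff_left)
  define q where "q = 1 - c / K"
  have q: "0 \<le> q" "q < 1"
    using K c by (auto simp: q_def)
  \<comment> \<open>The bound \<open>q\<close> on the form of \<open>S\<close> becomes a bound on
    its norm: this estimate yields \<open>(norm S)\<^sup>2 \<le> norm S * q\<close>, where one
    factor cancels.\<close>
  have "(norm (bop_apply S x))\<^sup>2 \<le> norm S * q * (norm x)\<^sup>2" for x
  proof -
    have "inner (bop_apply S x) x \<le> q * (norm x)\<^sup>2"
      using coercive[of x] K by (simp add: S_form q_def field_simps)
    then have "norm S * inner (bop_apply S x) x \<le> norm S * (q * (norm x)\<^sup>2)"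
      by (rule mult_left_mono) simp
    with bop_psd_norm_square_le[OF S, of x] show ?thesis
      by (simp add: mult.assoc)
  qed
  then have "norm (bop_apply S x) \<le> sqrt (norm S * q) * norm x" for x
    using real_le_rsqrt[of "norm (bop_apply S x)" "norm S * q * (norm x)\<^sup>2"]
    by (simp add: real_sqrt_mult)
  then have "norm S \<le> sqrt (norm S * q)"
    using q by (intro norm_bop_bound) auto
  then have "(norm S)\<^sup>2 \<le> norm S * q"
    using power_mono[of "norm S" "sqrt (norm S * q)" 2] q by simp
  then have "norm S \<le> q"
    using q by (cases "norm S = 0") (auto simp: power2_eq_square)
  then have "bop_invertible (K *\<^sub>R (1 - S))"
    using K q by (intro bop_invertible_scaleR bop_invertible_one_minus) auto
  moreover have "K *\<^sub>R (1 - S) = T"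
    using K by (simp add: S_def)
  ultimately show ?thesis
    using T by (simp add: bop_pos_def)
qed

text \<open>A single coercive summand suffices: the others have nonnegative forms, so the sum
  inherits the constant \<open>w j * c\<close>.\<close>

lemma bop_pos_weighted_sum:
  assumes I: "finite I" "I \<noteq> {}"
    and w: "\<And>i. i \<in> I \<Longrightarrow> 0 < w i" and T: "\<And>i. i \<in> I \<Longrightarrow> T i \<in> bop_pos"
  shows "(\<Sum>i\<in>I. w i *\<^sub>R T i) \<in> bop_pos"
proof -
  from I obtain j where j: "j \<in> I" by blast
  obtain c where c: "c > 0" "\<And>x. c * (norm x)\<^sup>2 \<le> inner (bop_apply (T j) x) x"
    using bop_pos_coercive[OF T[OF j]] by metis
  have psd: "bop_psd (w i *\<^sub>R T i)" if "i \<in> I" for i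
    using w[OF that] T[OF that] by (simp add: bop_psd_scaleR bop_pos_def)
  show ?thesis
  proof (rule bop_pos_if_coercive)
    show "bop_psd (\<Sum>i\<in>I. w i *\<^sub>R T i)"
      by (rule bop_psd_sum[OF psd])
    show "w j * c > 0"
      using c w[OF j] by simp
    fix x
    have "w j * c * (norm x)\<^sup>2 \<le> inner (bop_apply (w j *\<^sub>R T j) x) x"
      using c(2)[of x] w[OF j] by (simp add: bop_apply_scaleR)
    also have "\<dots> \<le> (\<Sum>i\<in>I. inner (bop_apply (w i *\<^sub>R T i) x) x)"
      using I j psd by (intro member_le_sum bop_psd_nonneg) auto
    also have "\<dots> = inner (bop_apply (\<Sum>i\<in>I. w i *\<^sub>R T i) x) x"
      by (simp add: linear_sum[OF bounded_linear.linear[OF bounded_linear_bop_inner]])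
    finally show "w j * c * (norm x)\<^sup>2 \<le> inner (bop_apply (\<Sum>i\<in>I. w i *\<^sub>R T i) x) x" .
  qed
qed

section \<open>Inverses of positive operators\<close>

lemma bop_inv:
  assumes "bop_invertible T"
  shows "T * bop_inv T = 1" "bop_inv T * T = 1"
proof -
  from assms obtain S where S: "T * S = 1" "S * T = 1"
    by (auto simp: bop_invertible_def)
  have "S' = S" if "T * S' = 1 \<and> S' * T = 1" for S'
  proof -
    have "S' = S * T * S'" by (simp only: S mult_1_left)
    also have "\<dots> = S" using that by (simp only: mult.assoc mult_1_right)
    finally show ?thesis .
  qed
  with S have "T * bop_inv T = 1 \<and> bop_inv T * T = 1"
    unfolding bop_inv_def by (intro theI[where a = S and P = "\<lambda>B. T * B = 1 \<and> B * T = 1"]) blast+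
  then show "T * bop_inv T = 1" "bop_inv T * T = 1" by blast+
qed

lemma bop_apply_inv:
  assumes "bop_invertible T"
  shows "bop_apply T (bop_apply (bop_inv T) x) = x"
  using bop_inv(1)[OF assms] by (metis bop_apply_one bop_apply_times)

lemma bop_inv_pos:
  assumes "T \<in> bop_pos"
  shows "bop_inv T \<in> bop_pos"
proof -
  have T: "bop_psd T" "bop_invertible T"
    using assms by (auto simp: bop_pos_def)
  \<comment> \<open>Substituting \<open>x = T y\<close> turns the form of the inverse into the form
    of \<open>T\<close>.\<close>
  have "cinner (bop_apply (bop_inv T) x) x = cinner (bop_apply T y) y"
    if "y = bop_apply (bop_inv T) x" for x y
    using bop_apply_inv[OF T(2), of x] bop_psd_cinner_symmetric[OF T(1), of y y] that by simp
  then have "bop_psd (bop_inv T)"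
    using T(1) by (simp add: bop_psd_def)
  then show ?thesis
    using bop_inv[OF T(2)] by (auto simp: bop_pos_def bop_invertible_def)
qed

text \<open>Equality holds for \<open>y = T\<^sup>-\<^sup>1 x\<close>. The bound is linear in \<open>T\<close>, which gives Jensen's inequality
  for the inverse without integrating an inverse.\<close>

lemma bop_inv_inner_ge:
  assumes "T \<in> bop_pos"
  shows "2 * inner x y - inner (bop_apply T y) y \<le> inner (bop_apply (bop_inv T) x) x"
proof -
  have T: "bop_psd T" "bop_invertible T"
    using assms by (auto simp: bop_pos_def)
  let ?z = "bop_apply (bop_inv T) x"
  have "0 \<le> inner (bop_apply T (?z - y)) (?z - y)"
    by (rule bop_psd_nonneg[OF T(1)])
  then show ?thesis
    by (simp add: bop_psd_inner_diff[OF T(1)] bop_apply_inv[OF T(2)]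
        inner_commute[of "bop_apply (bop_inv T) x"])
qed

section \<open>Integrals against functionals\<close>

text \<open>A limit that exists only almost everywhere need not be measurable. The pointwise
  \<open>lim\<close> is a measurable version of it.\<close>

lemma AE_limit_measurable:
  fixes h :: "nat \<Rightarrow> 's \<Rightarrow> real"
  assumes "\<And>k. h k \<in> borel_measurable \<mu>" "AE \<omega> in \<mu>. (\<lambda>k. h k \<omega>) \<longlonglongrightarrow> f \<omega>"
  obtains g where "g \<in> borel_measurable \<mu>" "AE \<omega> in \<mu>. g \<omega> = f \<omega>"
proof
  show "(\<lambda>\<omega>. lim (\<lambda>k. h k \<omega>)) \<in> borel_measurable \<mu>"
    using assms(1) by (rule borel_measurable_lim_metric)
  show "AE \<omega> in \<mu>. lim (\<lambda>k. h k \<omega>) = f \<omega>"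
    using assms(2) by eventually_elim (rule limI)
qed

text \<open>The integrands need not be Borel measurable, but the norms of the differences are almost
  everywhere limits of simple functions.\<close>

lemma bounded_linear_nn_integral_tendsto_0:
  fixes f :: "'s \<Rightarrow> 'b::banach" and h :: "'b \<Rightarrow> 'c::real_normed_vector"
  assumes s: "\<And>k. Bochner_Integration.simple_bochner_integrable \<mu> (s k)"
    and lim: "AE \<omega> in \<mu>. (\<lambda>k. s k \<omega>) \<longlonglongrightarrow> f \<omega>"
    and zero: "(\<lambda>k. \<integral>\<^sup>+ \<omega>. ennreal (norm (f \<omega> - s k \<omega>)) \<partial>\<mu>) \<longlonglongrightarrow> 0"
    and h: "bounded_linear h"
  shows "(\<lambda>k. \<integral>\<^sup>+ \<omega>. ennreal (norm (h (f \<omega>) - h (s k \<omega>))) \<partial>\<mu>) \<longlonglongrightarrow> 0"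
proof -
  interpret h: bounded_linear h by fact
  obtain K where K: "0 \<le> K" "\<And>x. norm (h x) \<le> norm x * K"
    using h.nonneg_bounded by blast
  have bound: "(\<integral>\<^sup>+ \<omega>. ennreal (norm (h (f \<omega>) - h (s k \<omega>))) \<partial>\<mu>)
      \<le> ennreal K * (\<integral>\<^sup>+ \<omega>. ennreal (norm (f \<omega> - s k \<omega>)) \<partial>\<mu>)" for k
  proof -
    have "simple_function \<mu> (\<lambda>\<omega>. norm (s j \<omega> - s k \<omega>))" for j
      using s by (intro simple_function_compose2[where h = "\<lambda>x y. norm (x - y)"])
        (auto elim: simple_bochner_integrable.cases)
    then have meas: "(\<lambda>\<omega>. norm (s j \<omega> - s k \<omega>)) \<in> borel_measurable \<mu>" for j
      by (rule borel_measurable_simple_function)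
    have lim_norm: "AE \<omega> in \<mu>. (\<lambda>j. norm (s j \<omega> - s k \<omega>)) \<longlonglongrightarrow> norm (f \<omega> - s k \<omega>)"
      using lim by eventually_elim (intro tendsto_intros)
    \<comment> \<open>Measurability of this version \<open>d\<close> is what allows the constant
      \<open>K\<close> to be pulled out of the integral.\<close>
    obtain d where d: "d \<in> borel_measurable \<mu>" "AE \<omega> in \<mu>. d \<omega> = norm (f \<omega> - s k \<omega>)"
      by (rule AE_limit_measurable[OF meas lim_norm])
    have "(\<integral>\<^sup>+ \<omega>. ennreal (norm (h (f \<omega>) - h (s k \<omega>))) \<partial>\<mu>) \<le> (\<integral>\<^sup>+ \<omega>. ennreal K * ennreal (d \<omega>) \<partial>\<mu>)"
    proof (rule nn_integral_mono_AE)
      show "AE \<omega> in \<mu>. ennreal (norm (h (f \<omega>) - h (s k \<omega>))) \<le> ennreal K * ennreal (d \<omega>)"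
        using d(2)
      proof eventually_elim
        case (elim \<omega>)
        have "norm (h (f \<omega>) - h (s k \<omega>)) \<le> K * d \<omega>"
          using K(2)[of "f \<omega> - s k \<omega>"] unfolding h.diff elim mult.commute[of K] .
        then show ?case
          unfolding ennreal_mult'[OF K(1), symmetric] by (rule ennreal_leI)
      qed
    qed
    also have "\<dots> = ennreal K * (\<integral>\<^sup>+ \<omega>. ennreal (d \<omega>) \<partial>\<mu>)"
      using d(1) by (intro nn_integral_cmult) auto
    also have "(\<integral>\<^sup>+ \<omega>. ennreal (d \<omega>) \<partial>\<mu>) = (\<integral>\<^sup>+ \<omega>. ennreal (norm (f \<omega> - s k \<omega>)) \<partial>\<mu>)"
      using d(2) by (intro nn_integral_cong_AE) auto
    finally show ?thesis .
  qed
  have "(\<lambda>k. ennreal K * (\<integral>\<^sup>+ \<omega>. ennreal (norm (f \<omega> - s k \<omega>)) \<partial>\<mu>)) \<longlonglongrightarrow> ennreal K * 0"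
    by (rule ennreal_tendsto_cmult[OF _ zero]) simp
  then have "(\<lambda>k. ennreal K * (\<integral>\<^sup>+ \<omega>. ennreal (norm (f \<omega> - s k \<omega>)) \<partial>\<mu>)) \<longlonglongrightarrow> 0"
    by simp
  then show ?thesis
    by (rule tendsto_sandwich[OF always_eventually always_eventually tendsto_const, rotated 2])
      (simp_all add: bound)
qed

lemma simple_bochner_integrable_bounded_linear:
  assumes "Bochner_Integration.simple_bochner_integrable \<mu> f" "bounded_linear h"
  shows "Bochner_Integration.simple_bochner_integrable \<mu> (\<lambda>\<omega>. h (f \<omega>))"
  \<comment> \<open>The binary composition rule is used with a function that ignores its second
    argument; its requirement at zero is \<open>h 0 = 0\<close>.\<close>
  using simple_bochner_integrable_compose2[where p = "\<lambda>x y. h x", OF _ assms(1) assms(1)]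
  by (simp add: linear_0[OF bounded_linear.linear[OF assms(2)]])

text \<open>Applying \<open>h\<close> to the approximating simple functions gives an approximating
  sequence for the image. This serves both congruences by \<open>X\<close> and scalar
  functionals.\<close>

lemma has_bochner_int_bounded_linear:
  fixes f :: "'s \<Rightarrow> 'b::banach" and h :: "'b \<Rightarrow> 'c::banach"
  assumes f: "has_bochner_int \<mu> f I" and h: "bounded_linear h"
  shows "has_bochner_int \<mu> (\<lambda>\<omega>. h (f \<omega>)) (h I)"
proof -
  obtain s where s: "\<And>k. Bochner_Integration.simple_bochner_integrable \<mu> (s k)"
      "AE \<omega> in \<mu>. (\<lambda>k. s k \<omega>) \<longlonglongrightarrow> f \<omega>"
      "(\<lambda>k. \<integral>\<^sup>+ \<omega>. ennreal (norm (f \<omega> - s k \<omega>)) \<partial>\<mu>) \<longlonglongrightarrow> 0"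
      "(\<lambda>k. Bochner_Integration.simple_bochner_integral \<mu> (s k)) \<longlonglongrightarrow> I"
    using f unfolding has_bochner_int_def by blast
  show ?thesis
    unfolding has_bochner_int_def
  proof (intro exI[of _ "\<lambda>k \<omega>. h (s k \<omega>)"] conjI allI)
    show "Bochner_Integration.simple_bochner_integrable \<mu> (\<lambda>\<omega>. h (s k \<omega>))" for k
      by (rule simple_bochner_integrable_bounded_linear[OF s(1) h])
    show "AE \<omega> in \<mu>. (\<lambda>k. h (s k \<omega>)) \<longlonglongrightarrow> h (f \<omega>)"
      using s(2) by eventually_elim (rule bounded_linear.tendsto[OF h])
    show "(\<lambda>k. \<integral>\<^sup>+ \<omega>. ennreal (norm (h (f \<omega>) - h (s k \<omega>))) \<partial>\<mu>) \<longlonglongrightarrow> 0"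
      by (rule bounded_linear_nn_integral_tendsto_0[OF s(1,2,3) h])
    show "(\<lambda>k. Bochner_Integration.simple_bochner_integral \<mu> (\<lambda>\<omega>. h (s k \<omega>))) \<longlonglongrightarrow> h I"
      by (simp add: simple_bochner_integral_linear[OF bounded_linear.linear[OF h] s(1)]
          bounded_linear.tendsto[OF h s(4)])
  qed
qed

text \<open>The composite of \<open>\<phi>\<close> and \<open>f\<close> may fail to be Borel
  measurable, so the scalar integral is attached to a version \<open>g\<close> that agrees with it
  almost everywhere.\<close>

lemma has_bochner_int_functional:
  fixes f :: "'s \<Rightarrow> 'b::banach" and \<phi> :: "'b \<Rightarrow> real"
  assumes f: "has_bochner_int \<mu> f I" and \<phi>: "bounded_linear \<phi>"
  obtains g where "has_bochner_integral \<mu> g (\<phi> I)" "AE \<omega> in \<mu>. g \<omega> = \<phi> (f \<omega>)"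
proof -
  obtain s where s: "\<And>k. Bochner_Integration.simple_bochner_integrable \<mu> (s k)"
      "AE \<omega> in \<mu>. (\<lambda>k. s k \<omega>) \<longlonglongrightarrow> \<phi> (f \<omega>)"
      "(\<lambda>k. \<integral>\<^sup>+ \<omega>. ennreal (norm (\<phi> (f \<omega>) - s k \<omega>)) \<partial>\<mu>) \<longlonglongrightarrow> 0"
      "(\<lambda>k. Bochner_Integration.simple_bochner_integral \<mu> (s k)) \<longlonglongrightarrow> \<phi> I"
    using has_bochner_int_bounded_linear[OF f \<phi>] unfolding has_bochner_int_def by blast
  have meas: "s k \<in> borel_measurable \<mu>" for k
    using s(1)[of k] by (auto elim: simple_bochner_integrable.cases intro: borel_measurable_simple_function)
  obtain g where g: "g \<in> borel_measurable \<mu>" "AE \<omega> in \<mu>. g \<omega> = \<phi> (f \<omega>)"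
    by (rule AE_limit_measurable[OF meas s(2)])
  have "(\<integral>\<^sup>+ \<omega>. ennreal (norm (g \<omega> - s k \<omega>)) \<partial>\<mu>) = (\<integral>\<^sup>+ \<omega>. ennreal (norm (\<phi> (f \<omega>) - s k \<omega>)) \<partial>\<mu>)" for k
    using g(2) by (intro nn_integral_cong_AE) auto
  then have "has_bochner_integral \<mu> g (\<phi> I)"
    using s by (intro has_bochner_integral.intros[OF g(1)]) auto
  with g(2) show thesis by (rule that[rotated])
qed

lemma has_bochner_int_cong:
  assumes "\<And>\<omega>. \<omega> \<in> space \<mu> \<Longrightarrow> f \<omega> = g \<omega>"
  shows "has_bochner_int \<mu> f I \<longleftrightarrow> has_bochner_int \<mu> g I"
proof -
  have "(AE \<omega> in \<mu>. (\<lambda>k. s k \<omega>) \<longlonglongrightarrow> f \<omega>) \<longleftrightarrow> (AE \<omega> in \<mu>. (\<lambda>k. s k \<omega>) \<longlonglongrightarrow> g \<omega>)" for s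
    using assms by (intro AE_cong) simp
  moreover have "(\<integral>\<^sup>+ \<omega>. ennreal (norm (f \<omega> - s \<omega>)) \<partial>\<mu>) = (\<integral>\<^sup>+ \<omega>. ennreal (norm (g \<omega> - s \<omega>)) \<partial>\<mu>)" for s
    using assms by (intro nn_integral_cong) simp
  ultimately show ?thesis
    unfolding has_bochner_int_def by simp
qed

text \<open>The functionals \<open>inner (bop_apply T x) y\<close> already separate
  operators.\<close>

lemma bop_eq_if_functionals_eq:
  fixes S T :: "'a::chilbert_space bop"
  assumes "\<And>\<phi> :: 'a bop \<Rightarrow> real. bounded_linear \<phi> \<Longrightarrow> \<phi> S = \<phi> T"
  shows "S = T"
proof (rule bop_eqI)
  fix x
  have "inner (bop_apply S x) y = inner (bop_apply T x) y" for y
    by (rule assms[OF bounded_linear_bop_inner])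
  then show "bop_apply S x = bop_apply T x"
    by (metis vector_eq_rdot)
qed

text \<open>Each functional reduces the claim to uniqueness of a Lebesgue integral. This makes the
  definite description in \<open>bochner_integral\<close> denote the integral.\<close>

lemma has_bochner_int_unique:
  fixes f :: "'s \<Rightarrow> 'a::chilbert_space bop"
  assumes I: "has_bochner_int \<mu> f I" and J: "has_bochner_int \<mu> f J"
  shows "I = J"
proof (rule bop_eq_if_functionals_eq)
  fix \<phi> :: "'a bop \<Rightarrow> real"
  assume \<phi>: "bounded_linear \<phi>"
  obtain g where g: "has_bochner_integral \<mu> g (\<phi> I)" "AE \<omega> in \<mu>. g \<omega> = \<phi> (f \<omega>)"
    by (rule has_bochner_int_functional[OF I \<phi>])
  obtain h where h: "has_bochner_integral \<mu> h (\<phi> J)" "AE \<omega> in \<mu>. h \<omega> = \<phi> (f \<omega>)"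
    by (rule has_bochner_int_functional[OF J \<phi>])
  have "AE \<omega> in \<mu>. g \<omega> = h \<omega>"
    using g(2) h(2) by eventually_elim simp
  then have "integral\<^sup>L \<mu> g = integral\<^sup>L \<mu> h"
    using g(1) h(1) by (intro integral_cong_AE) (auto dest: borel_measurable_has_bochner_integral)
  then show "\<phi> I = \<phi> J"
    using g(1) h(1) by (simp add: has_bochner_integral_integral_eq)
qed

lemma bochner_integral_eq:
  fixes f :: "'s \<Rightarrow> 'a::chilbert_space bop"
  assumes "has_bochner_int \<mu> f I"
  shows "bochner_integral \<mu> f = I"
  unfolding bochner_integral_def
proof (rule the_equality)
  show "has_bochner_int \<mu> f I" by (rule assms)
  show "J = I" if "has_bochner_int \<mu> f J" for J
    using that assms by (rule has_bochner_int_unique)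
qed

section \<open>The simplex in coordinates\<close>

text \<open>The product measure before completion, on which iterated integrals and images of Borel
  sets are handled; \<open>has_bochner_int_simplex_functional\<close> links it to
  \<open>simplex_measure\<close>.\<close>

definition coords_measure :: "nat \<Rightarrow> (nat \<Rightarrow> real) measure" where
  "coords_measure n = (\<Pi>\<^sub>M i\<in>{1..<n}. lborel)"

definition simplex_coords :: "nat \<Rightarrow> (nat \<Rightarrow> real) set" where
  "simplex_coords n = {x \<in> {1..<n} \<rightarrow>\<^sub>E UNIV. weights_of_coords n x \<in> simplex_weights n}"

definition swap_last_coord :: "nat \<Rightarrow> nat \<Rightarrow> (nat \<Rightarrow> real) \<Rightarrow> nat \<Rightarrow> real" where
  "swap_last_coord n a x = x(a := 1 - (\<Sum>i\<in>{1..<n}. x i))"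

lemma product_sigma_finite_lborel: "product_sigma_finite (\<lambda>_. lborel :: real measure)"
  by standard

lemma space_coords_measure: "space (coords_measure n) = {1..<n} \<rightarrow>\<^sub>E UNIV"
  by (simp add: coords_measure_def space_PiM)

lemma measurable_coord [measurable]:
  "i \<in> {1..<n} \<Longrightarrow> (\<lambda>x. x i) \<in> borel_measurable (coords_measure n)"
  unfolding coords_measure_def by measurable

lemma measurable_sum_coords [measurable]:
  "(\<lambda>x. \<Sum>i\<in>{1..<n}. x i) \<in> borel_measurable (coords_measure n)"
  by (rule borel_measurable_sum) measurable

text \<open>The new sum is \<open>1\<close> minus the old coordinate, so the new last weight is
  \<open>x a\<close>. Hence the map is an involution and acts on the weights as a
  transposition.\<close>

lemma sum_swap_last_coord:
  assumes "a \<in> {1..<n}"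
  shows "(\<Sum>i\<in>{1..<n}. swap_last_coord n a x i) = 1 - x a"
proof -
  let ?I = "{1..<n} - {a}"
  have split: "(\<Sum>i\<in>{1..<n}. y i) = y a + (\<Sum>i\<in>?I. y i)" for y :: "nat \<Rightarrow> real"
    using assms by (intro sum.remove) auto
  have "(\<Sum>i\<in>?I. swap_last_coord n a x i) = (\<Sum>i\<in>?I. x i)"
    by (intro sum.cong) (auto simp: swap_last_coord_def)
  with split[of x] split[of "swap_last_coord n a x"] show ?thesis
    by (simp add: swap_last_coord_def[of n a x])
qed

lemma swap_last_coord_swap_last_coord:
  assumes "a \<in> {1..<n}"
  shows "swap_last_coord n a (swap_last_coord n a x) = x"
  using sum_swap_last_coord[OF assms, of x]
  by (simp add: swap_last_coord_def[of n a "swap_last_coord n a x"]) (simp add: swap_last_coord_def)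

lemma atLeastAtMost_eq_insert_last: "1 \<le> n \<Longrightarrow> {1..n} = insert n {1..<n}" for n :: nat
  by auto

text \<open>The last weight lies strictly between 0 and 1 exactly when the sum of the coordinates
  does. This form exhibits the domain as a Borel set.\<close>

lemma simplex_coords_iff:
  assumes "1 \<le> n"
  shows "x \<in> simplex_coords n \<longleftrightarrow> x \<in> space (coords_measure n) \<and>
    (\<forall>i\<in>{1..<n}. 0 < x i \<and> x i < 1) \<and> 0 < (\<Sum>i\<in>{1..<n}. x i) \<and> (\<Sum>i\<in>{1..<n}. x i) < 1"
proof -
  have "(\<Sum>k\<in>{1..<n}. (x(n := y)) k) = (\<Sum>k\<in>{1..<n}. x k)" for y
    by (intro sum.cong) auto
  then show ?thesis
    unfolding simplex_coords_def simplex_weights_def weights_of_coords_def space_coords_measure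
      atLeastAtMost_eq_insert_last[OF assms]
    by (auto simp: PiE_iff extensional_def)
qed

lemma simplex_coords_sets [measurable]:
  assumes "1 \<le> n"
  shows "simplex_coords n \<in> sets (coords_measure n)"
proof -
  have "simplex_coords n = {x \<in> space (coords_measure n).
    (\<forall>i\<in>{1..<n}. 0 < x i \<and> x i < 1) \<and> 0 < (\<Sum>i\<in>{1..<n}. x i) \<and> (\<Sum>i\<in>{1..<n}. x i) < 1}"
    using simplex_coords_iff[OF assms] by blast
  also have "\<dots> \<in> sets (coords_measure n)"
    by measurable
  finally show ?thesis .
qed

text \<open>Overwriting index \<open>n\<close> loses nothing, since there all functions in the
  domain take the value \<open>undefined\<close>.\<close>

lemma inj_on_weights_of_coords: "inj_on (weights_of_coords n) ({1..<n} \<rightarrow>\<^sub>E UNIV)"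
proof (rule inj_onI)
  fix x y
  assume xy: "x \<in> {1..<n} \<rightarrow>\<^sub>E UNIV" "y \<in> {1..<n} \<rightarrow>\<^sub>E UNIV"
    and eq: "weights_of_coords n x = weights_of_coords n y"
  have "x i = y i" for i
    using fun_cong[OF eq, of i] PiE_arb[OF xy(1), of n] PiE_arb[OF xy(2), of n]
    by (cases "i = n") (auto simp: weights_of_coords_def)
  then show "x = y" ..
qed

lemma space_simplex_measure: "space (simplex_measure n) \<subseteq> simplex_weights n"
  by (auto simp: simplex_measure_def space_embed_measure space_restrict_space)

text \<open>The layers of \<open>simplex_measure\<close> are removed in turn: the embedding is an
  image measure because the map is injective, the restriction becomes an indicator, and the
  completion is left by choosing a Borel version.\<close>

lemma has_bochner_int_simplex_functional:
  fixes f :: "(nat \<Rightarrow> real) \<Rightarrow> 'b::banach" and \<phi> :: "'b \<Rightarrow> real"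
  assumes n: "1 \<le> n" and f: "has_bochner_int (simplex_measure n) f I" and \<phi>: "bounded_linear \<phi>"
  obtains g where "has_bochner_integral (coords_measure n) g (\<phi> I)"
    "AE x in coords_measure n. g x = indicator (simplex_coords n) x * \<phi> (f (weights_of_coords n x))"
proof -
  let ?P = "coords_measure n" and ?D = "simplex_coords n" and ?W = "weights_of_coords n"
  let ?R = "restrict_space (completion ?P) ?D"
  let ?\<mu> = "simplex_measure n"
  have \<mu>_def: "?\<mu> = embed_measure ?R ?W"
    by (simp add: simplex_measure_def simplex_coords_def coords_measure_def)
  have D: "?D \<inter> space (completion ?P) \<in> sets (completion ?P)"
    using simplex_coords_sets[OF n] by auto
  have inj: "inj_on ?W (space ?R)"
    by (rule inj_on_subset[OF inj_on_weights_of_coords])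
      (auto simp: space_restrict_space simplex_coords_def)
  have W: "?W \<in> measurable ?R ?\<mu>"
    unfolding \<mu>_def by (rule measurable_embed_measure2'[OF inj])
  have distr: "?\<mu> = distr ?R ?\<mu> ?W"
    unfolding \<mu>_def by (rule embed_measure_eq_distr'[OF inj])
  obtain g where g: "has_bochner_integral ?\<mu> g (\<phi> I)" "AE \<omega> in ?\<mu>. g \<omega> = \<phi> (f \<omega>)"
    by (rule has_bochner_int_functional[OF f \<phi>])
  have g_meas: "g \<in> borel_measurable ?\<mu>"
    using g(1) by (rule borel_measurable_has_bochner_integral)
  define g1 where "g1 x = indicator ?D x *\<^sub>R g (?W x)" for x
  have "integrable (distr ?R ?\<mu> ?W) g" "integral\<^sup>L (distr ?R ?\<mu> ?W) g = \<phi> I"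
    using g(1) distr by (simp_all add: has_bochner_integral_iff)
  then have "integrable ?R (\<lambda>x. g (?W x))" "integral\<^sup>L ?R (\<lambda>x. g (?W x)) = \<phi> I"
    using integrable_distr_eq[OF W g_meas] integral_distr[OF W g_meas] by auto
  then have g1: "integrable (completion ?P) g1" "integral\<^sup>L (completion ?P) g1 = \<phi> I"
    unfolding integrable_restrict_space[OF D] integral_restrict_space[OF D] g1_def[abs_def] by auto
  \<comment> \<open>Measurability of \<open>g1\<close> is known for the completion; a Borel version
    \<open>g2\<close> has the same integral.\<close>
  obtain g2 where g2: "g2 \<in> borel_measurable ?P" "AE x in ?P. g1 x = g2 x"
    using completion_ex_borel_measurable_real g1(1) by blast
  have g2': "g2 \<in> borel_measurable (completion ?P)"
    using g2(1) by (rule measurable_completion)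
  have ae: "AE x in completion ?P. g1 x = g2 x"
    using g2(2) by (rule AE_completion)
  have "integrable (completion ?P) g2" "integral\<^sup>L (completion ?P) g2 = \<phi> I"
    using g1 g2' ae integrable_cong_AE[of g1 "completion ?P" g2] integral_cong_AE[of g1 "completion ?P" g2]
    by auto
  then have "has_bochner_integral ?P g2 (\<phi> I)"
    using g2(1) by (simp add: has_bochner_integral_iff integrable_completion integral_completion)
  moreover have "AE \<omega> in distr ?R ?\<mu> ?W. g \<omega> = \<phi> (f \<omega>)"
    using g(2) by (simp only: distr[symmetric])
  then have "AE x in ?R. g (?W x) = \<phi> (f (?W x))"
    by (rule AE_distrD[OF W])
  then have "AE x in ?P. x \<in> ?D \<longrightarrow> g (?W x) = \<phi> (f (?W x))"
    unfolding AE_restrict_space_iff[OF D] AE_completion_iff .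
  then have "AE x in ?P. g2 x = indicator ?D x * \<phi> (f (?W x))"
    using g2(2) by eventually_elim (auto simp: g1_def indicator_def split: if_splits)
  ultimately show thesis by (rule that)
qed

lemma swap_last_coord_measurable [measurable]:
  assumes "a \<in> {1..<n}"
  shows "swap_last_coord n a \<in> measurable (coords_measure n) (coords_measure n)"
proof -
  have "(\<lambda>x. swap_last_coord n a x) \<in> measurable (coords_measure n) (\<Pi>\<^sub>M i\<in>{1..<n}. lborel)"
  proof (rule measurable_PiM_single')
    show "(\<lambda>x. swap_last_coord n a x i) \<in> measurable (coords_measure n) lborel" if "i \<in> {1..<n}" for i
      using that by (cases "i = a") (auto simp: swap_last_coord_def)
    show "(\<lambda>x i. swap_last_coord n a x i) \<in> space (coords_measure n) \<rightarrow> {1..<n} \<rightarrow>\<^sub>E space lborel"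
      using assms by (auto simp: swap_last_coord_def space_coords_measure PiE_iff extensional_def)
  qed
  then show ?thesis by (simp add: coords_measure_def)
qed

text \<open>With the other coordinates fixed, the map is a reflection \<open>y \<mapsto> c - y\<close> of the line.\<close>

lemma distr_swap_last_coord:
  assumes a: "a \<in> {1..<n}"
  shows "distr (coords_measure n) (coords_measure n) (swap_last_coord n a) = coords_measure n"
proof (rule measure_eqI)
  interpret product_sigma_finite "\<lambda>_. lborel :: real measure"
    by (rule product_sigma_finite_lborel)
  let ?P = "coords_measure n" and ?r = "swap_last_coord n a"
  \<comment> \<open>Splitting off coordinate \<open>a\<close> makes it the variable of the inner
    integral, where a substitution of slope -1 applies.\<close>
  define J where "J = {1..<n} - {a}"
  have J: "finite J" "a \<notin> J" "insert a J = {1..<n}"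
    using a by (auto simp: J_def)
  have P: "?P = Pi\<^sub>M (insert a J) (\<lambda>_. lborel)"
    by (simp add: coords_measure_def J(3))
  fix A
  assume "A \<in> sets (distr ?P ?P ?r)"
  then have A [measurable]: "A \<in> sets ?P" by simp
  note [measurable] = swap_last_coord_measurable[OF a]
  have meas_A: "(indicator A :: _ \<Rightarrow> ennreal) \<in> borel_measurable ?P"
    and meas_r: "(\<lambda>x. indicator A (?r x) :: ennreal) \<in> borel_measurable ?P"
    by measurable
  have "emeasure (distr ?P ?P ?r) A = (\<integral>\<^sup>+ x. indicator A (?r x) \<partial>?P)"
    by (subst nn_integral_indicator[symmetric], simp, subst nn_integral_distr) auto
  also have "\<dots> = (\<integral>\<^sup>+ x. \<integral>\<^sup>+ y. indicator A (?r (x(a := y))) \<partial>lborel \<partial>Pi\<^sub>M J (\<lambda>_. lborel))"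
    unfolding P by (rule product_nn_integral_insert[OF J(1,2) meas_r[unfolded P]])
  also have "\<dots> = (\<integral>\<^sup>+ x. \<integral>\<^sup>+ y. indicator A (x(a := y)) \<partial>lborel \<partial>Pi\<^sub>M J (\<lambda>_. lborel))"
  proof (rule nn_integral_cong)
    fix x assume x: "x \<in> space (Pi\<^sub>M J (\<lambda>_. lborel :: real measure))"
    have "(\<lambda>y. x(a := y)) \<in> measurable lborel (Pi\<^sub>M (insert a J) (\<lambda>_. lborel))"
      using x J by (intro measurable_fun_upd[where J = J]) auto
    then have "(\<lambda>y. x(a := y)) \<in> measurable borel ?P"
      by (simp add: P)
    then have meas: "(\<lambda>y. indicator A (x(a := y)) :: ennreal) \<in> borel_measurable borel"
      by measurable
    have "?r (x(a := y)) = x(a := (1 - (\<Sum>i\<in>J. x i)) + (-1) * y)" for y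
    proof -
      have "(\<Sum>i\<in>{1..<n}. (x(a := y)) i) = y + (\<Sum>i\<in>J. x i)"
        unfolding J(3)[symmetric] sum.insert[OF J(1,2)] using J(2)
        by (auto intro!: sum.cong arg_cong2[where f = "(+)"])
      then have "?r (x(a := y)) = x(a := 1 - (y + (\<Sum>i\<in>J. x i)))"
        by (simp only: swap_last_coord_def fun_upd_upd)
      then show ?thesis by (simp add: algebra_simps)
    qed
    then show "(\<integral>\<^sup>+ y. indicator A (?r (x(a := y))) \<partial>lborel) = (\<integral>\<^sup>+ y. indicator A (x(a := y)) \<partial>lborel)"
      by (subst nn_integral_real_affine[OF meas, of "-1" "1 - (\<Sum>i\<in>J. x i)"]) simp_all
  qed
  also have "\<dots> = (\<integral>\<^sup>+ x. indicator A x \<partial>?P)"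
    unfolding P by (rule product_nn_integral_insert[OF J(1,2) meas_A[unfolded P], symmetric])
  also have "\<dots> = emeasure ?P A"
    by simp
  finally show "emeasure (distr ?P ?P ?r) A = emeasure ?P A" .
qed simp

section \<open>Permutations acting on weights and coordinates\<close>

lemma permute_tuple_simplex_weights:
  assumes \<pi>: "\<pi> permutes {1..n}" and \<omega>: "\<omega> \<in> simplex_weights n"
  shows "permute_tuple n \<pi> \<omega> \<in> simplex_weights n"
proof -
  have "(\<Sum>k=1..n. permute_tuple n \<pi> \<omega> k) = (\<Sum>k=1..n. \<omega> (\<pi> k))"
    by (simp add: permute_tuple_def)
  also have "\<dots> = (\<Sum>k=1..n. \<omega> k)"
    using sum.permute[OF \<pi>, of \<omega>] by (simp add: comp_def)
  finally show ?thesis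
    using \<omega> permutes_in_image[OF \<pi>] by (auto simp: simplex_weights_def permute_tuple_def)
qed

lemma weights_swap_last_coord:
  assumes a: "a \<in> {1..<n}" and x: "x \<in> space (coords_measure n)"
  shows "weights_of_coords n (swap_last_coord n a x)
    = permute_tuple n (Transposition.transpose a n) (weights_of_coords n x)"
proof
  fix i
  have a_n: "a \<noteq> n" "a \<in> {1..n}" "n \<in> {1..n}" using a by auto
  consider "i = a" | "i = n" | "i \<in> {1..<n}" "i \<noteq> a" | "i \<notin> {1..n}" by fastforce
  then show "weights_of_coords n (swap_last_coord n a x) i
    = permute_tuple n (Transposition.transpose a n) (weights_of_coords n x) i"
  proof cases
    case 1
    then show ?thesis
      using a_n by (simp add: weights_of_coords_def permute_tuple_def swap_last_coord_def)
  next
    case 2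
    then show ?thesis
      using a_n sum_swap_last_coord[OF a, of x]
      by (simp add: weights_of_coords_def permute_tuple_def)
  next
    case 3
    then show ?thesis
      by (simp add: weights_of_coords_def permute_tuple_def swap_last_coord_def
          transpose_apply_other)
  next
    \<comment> \<open>Outside \<open>{1..n}\<close> both sides are \<open>undefined\<close>: the
      left because \<open>x\<close> is extensional, the right by the restriction in
      \<open>permute_tuple\<close>.\<close>
    case 4
    then have "i \<noteq> a" "i \<noteq> n" "i \<notin> {1..<n}" using a_n by auto
    then show ?thesis
      using 4 x PiE_arb[of x "{1..<n}" _ i]
      by (simp add: weights_of_coords_def permute_tuple_def swap_last_coord_def
          space_coords_measure)
  qed
qed

text \<open>One implication suffices, since the map is an involution.\<close>

lemma swap_last_coord_simplex_iff:
  assumes a: "a \<in> {1..<n}" and x: "x \<in> space (coords_measure n)"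
  shows "swap_last_coord n a x \<in> simplex_coords n \<longleftrightarrow> x \<in> simplex_coords n"
proof -
  have imp: "swap_last_coord n a y \<in> simplex_coords n" if y: "y \<in> simplex_coords n" for y
  proof -
    have sp: "y \<in> space (coords_measure n)"
      using y by (simp add: simplex_coords_def space_coords_measure)
    have "Transposition.transpose a n permutes {1..n}"
      using a by (intro permutes_swap_id) auto
    then have "weights_of_coords n (swap_last_coord n a y) \<in> simplex_weights n"
      using y by (simp add: weights_swap_last_coord[OF a sp] permute_tuple_simplex_weights
          simplex_coords_def)
    moreover have "swap_last_coord n a y \<in> {1..<n} \<rightarrow>\<^sub>E UNIV"
      using measurable_space[OF swap_last_coord_measurable[OF a] sp] by (simp add: space_coords_measure)
    ultimately show ?thesis by (simp add: simplex_coords_def)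
  qed
  then show ?thesis
    using swap_last_coord_swap_last_coord[OF a, of x] by metis
qed

section \<open>Volume of the simplex and means of the weights\<close>

lemma AE_coord_nonzero:
  assumes a: "a \<in> {1..<n}"
  shows "AE x in coords_measure n. x a \<noteq> 0"
proof -
  interpret product_sigma_finite "\<lambda>_. lborel :: real measure"
    by (rule product_sigma_finite_lborel)
  \<comment> \<open>The hyperplane is a box with one factor \<open>{0}\<close>, hence a null
    set.\<close>
  let ?N = "Pi\<^sub>E {1..<n} (\<lambda>i. if i = a then {0} else UNIV :: real set)"
  have "emeasure (coords_measure n) ?N = (\<Prod>i\<in>{1..<n}. emeasure lborel (if i = a then {0} else UNIV :: real set))"
    unfolding coords_measure_def by (intro emeasure_PiM) auto
  also have "\<dots> = 0"
    using a by (intro prod_zero) auto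
  finally have "?N \<in> null_sets (coords_measure n)"
    unfolding coords_measure_def by (intro null_setsI sets_PiM_I_finite) auto
  then show ?thesis
    by (rule AE_I') (auto simp: space_coords_measure PiE_iff extensional_def)
qed

text \<open>Up to null faces this is the closed standard simplex of dimension \<open>n - 1\<close>,
  whose volume is known.\<close>

lemma emeasure_simplex_coords:
  assumes n: "2 \<le> n"
  shows "emeasure (coords_measure n) (simplex_coords n) = ennreal (1 / fact (n - 1))"
proof -
  let ?P = "coords_measure n"
  let ?S = "{x. (\<forall>i\<in>{1..<n}. 0 \<le> x i) \<and> sum x {1..<n} \<le> 1} \<inter> space ?P"
  have one: "1 \<in> {1..<n}" using n by auto
  have "AE x in ?P. x 1 \<noteq> 0"
    by (rule AE_coord_nonzero[OF one])
  \<comment> \<open>The slanted face, where the coordinates sum to 1, is the preimage of the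
    hyperplane \<open>x 1 = 0\<close> under a measure preserving map, hence null as well.\<close>
  then have "AE x in distr ?P ?P (swap_last_coord n 1). x 1 \<noteq> 0"
    by (simp only: distr_swap_last_coord[OF one])
  then have "AE x in ?P. swap_last_coord n 1 x 1 \<noteq> 0"
    by (rule AE_distrD[OF swap_last_coord_measurable[OF one]])
  then have ne: "AE x in ?P. (\<Sum>i\<in>{1..<n}. x i) \<noteq> 1"
    by (auto simp: swap_last_coord_def)
  have "AE x in ?P. \<forall>i\<in>{1..<n}. x i \<noteq> 0"
    by (rule AE_finite_allI) (auto intro: AE_coord_nonzero)
  with ne AE_space have "AE x in ?P. x \<in> simplex_coords n \<longleftrightarrow> x \<in> ?S"
  proof eventually_elim
    case (elim x)
    show ?case
    proof
      assume "x \<in> simplex_coords n"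
      then show "x \<in> ?S"
        using n by (auto simp: simplex_coords_iff less_imp_le)
    next
      assume x: "x \<in> ?S"
      then have pos: "0 < x i" if "i \<in> {1..<n}" for i
        using elim(3) that by (force simp: order.order_iff_strict)
      have lt: "(\<Sum>i\<in>{1..<n}. x i) < 1"
        using elim(1) x by auto
      have le: "x i \<le> (\<Sum>i\<in>{1..<n}. x i)" if "i \<in> {1..<n}" for i
        using that x by (intro member_le_sum) auto
      have "x i < 1" if "i \<in> {1..<n}" for i
        using le[OF that] lt by linarith
      moreover have "0 < (\<Sum>i\<in>{1..<n}. x i)"
        using le[OF one] pos[OF one] by linarith
      ultimately show "x \<in> simplex_coords n"
        using n elim(2) pos lt by (simp add: simplex_coords_iff)
    qed
  qed
  moreover have "?S \<in> sets ?P"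
  proof -
    have "?S = {x \<in> space ?P. (\<forall>i\<in>{1..<n}. 0 \<le> x i) \<and> (\<Sum>i\<in>{1..<n}. x i) \<le> 1}" by auto
    also have "\<dots> \<in> sets ?P" by measurable
    finally show ?thesis .
  qed
  ultimately have "emeasure ?P (simplex_coords n) = emeasure ?P ?S"
    using n by (intro emeasure_eq_AE simplex_coords_sets) auto
  also have "\<dots> = ennreal (1 ^ card {1..<n} / fact (card {1..<n}))"
    unfolding coords_measure_def by (rule emeasure_std_simplex_aux) auto
  finally show ?thesis by simp
qed

lemma has_bochner_integral_simplex:
  assumes n: "2 \<le> n"
  shows "has_bochner_integral (coords_measure n) (indicator (simplex_coords n)) (1 / fact (n - 1) :: real)"
proof -
  have "has_bochner_integral (coords_measure n) (indicator (simplex_coords n))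
      (measure (coords_measure n) (simplex_coords n))"
    using n emeasure_simplex_coords[OF n]
    by (intro has_bochner_integral_real_indicator simplex_coords_sets) auto
  then show ?thesis
    using emeasure_simplex_coords[OF n] by (simp add: measure_def)
qed

text \<open>By symmetry all weights have the same integral, and their sum is \<open>1\<close>.\<close>

lemma integral_weight:
  assumes n: "2 \<le> n" and i: "i \<in> {1..n}"
  shows "has_bochner_integral (coords_measure n)
    (\<lambda>x. indicator (simplex_coords n) x * weights_of_coords n x i) (1 / fact n)"
proof -
  let ?P = "coords_measure n" and ?D = "simplex_coords n" and ?W = "weights_of_coords n"
  let ?f = "\<lambda>i x. indicator ?D x * ?W x i"
  have D [measurable]: "?D \<in> sets ?P"
    using n by (intro simplex_coords_sets) simp
  have ind: "integrable ?P (indicator ?D :: _ \<Rightarrow> real)"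
    using has_bochner_integral_simplex[OF n] by (simp add: has_bochner_integral_iff)
  have meas: "?f j \<in> borel_measurable ?P" if "j \<in> {1..n}" for j
    using that by (cases "j = n") (auto simp: weights_of_coords_def)
  have int: "integrable ?P (?f j)" if "j \<in> {1..n}" for j
  proof (rule Bochner_Integration.integrable_bound[OF ind meas[OF that]])
    show "AE x in ?P. norm (?f j x) \<le> norm (indicator ?D x :: real)"
    proof (rule AE_I2)
      fix x
      have "x \<in> ?D \<Longrightarrow> ?W x j \<in> {0<..<1}"
        using that by (auto simp: simplex_coords_def simplex_weights_def PiE_iff)
      then show "norm (?f j x) \<le> norm (indicator ?D x :: real)"
        by (auto simp: indicator_def)
    qed
  qed
  have swap: "integral\<^sup>L ?P (?f a) = integral\<^sup>L ?P (?f n)" if a: "a \<in> {1..<n}" for a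
  proof -
    have a': "a \<in> {1..n}" and n': "n \<in> {1..n}" using a by auto
    have "integral\<^sup>L ?P (?f a) = integral\<^sup>L (distr ?P ?P (swap_last_coord n a)) (?f a)"
      by (simp only: distr_swap_last_coord[OF a])
    also have "\<dots> = (\<integral>x. ?f a (swap_last_coord n a x) \<partial>?P)"
      by (rule integral_distr[OF swap_last_coord_measurable[OF a] meas[OF a']])
    also have "\<dots> = integral\<^sup>L ?P (?f n)"
      using a a' by (intro Bochner_Integration.integral_cong)
        (auto simp: indicator_def swap_last_coord_simplex_iff weights_swap_last_coord permute_tuple_def)
    finally show ?thesis .
  qed
  have eq: "integral\<^sup>L ?P (?f j) = integral\<^sup>L ?P (?f n)" if "j \<in> {1..n}" for j
    using swap[of j] that by (cases "j = n") auto
  have "1 / fact (n - 1) = integral\<^sup>L ?P (indicator ?D :: _ \<Rightarrow> real)"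
    using has_bochner_integral_simplex[OF n] by (simp add: has_bochner_integral_iff)
  also have "\<dots> = (\<integral>x. (\<Sum>j=1..n. ?f j x) \<partial>?P)"
    by (intro Bochner_Integration.integral_cong)
      (auto simp: indicator_def simplex_coords_def simplex_weights_def)
  also have "\<dots> = (\<Sum>j=1..n. integral\<^sup>L ?P (?f j))"
    by (rule Bochner_Integration.integral_sum) (rule int)
  also have "\<dots> = (\<Sum>j=1..n. integral\<^sup>L ?P (?f n))"
    by (rule sum.cong[OF refl eq])
  also have "\<dots> = real n * integral\<^sup>L ?P (?f n)"
    by simp
  finally have "integral\<^sup>L ?P (?f n) = 1 / fact n"
    using n by (simp add: fact_reduce[of n] field_simps)
  then show ?thesis
    using int[OF i] eq[OF i] by (simp add: has_bochner_integral_iff)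
qed

section \<open>The logarithmic mean\<close>

text \<open>A bound affine in the weights integrates exactly: the factor \<open>fact (n - 1)\<close>
  turns the volume into 1 and the integral of each weight into \<open>1 / n\<close>. Both operator
  inequalities rest on this.\<close>

lemma simplex_integral_functional_le:
  fixes f :: "(nat \<Rightarrow> real) \<Rightarrow> 'b::banach" and \<phi> :: "'b \<Rightarrow> real"
  assumes n: "2 \<le> n" and f: "has_bochner_int (simplex_measure n) f I" and \<phi>: "bounded_linear \<phi>"
    and le: "\<And>\<omega>. \<omega> \<in> simplex_weights n \<Longrightarrow> \<phi> (f \<omega>) \<le> c + (\<Sum>i=1..n. \<omega> i * b i)"
  shows "fact (n - 1) * \<phi> I \<le> c + (\<Sum>i=1..n. b i) / real n"
proof -
  let ?P = "coords_measure n" and ?D = "simplex_coords n" and ?W = "weights_of_coords n"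
  have n1: "1 \<le> n" using n by simp
  obtain g where g: "has_bochner_integral ?P g (\<phi> I)"
      "AE x in ?P. g x = indicator ?D x * \<phi> (f (?W x))"
    by (rule has_bochner_int_simplex_functional[OF n1 f \<phi>])
  let ?h = "\<lambda>x. indicator ?D x * c + (\<Sum>i=1..n. indicator ?D x * ?W x i * b i)"
  have h: "has_bochner_integral ?P ?h (1 / fact (n - 1) * c + (\<Sum>i=1..n. 1 / fact n * b i))"
    by (intro has_bochner_integral_add has_bochner_integral_sum has_bochner_integral_mult_left
        has_bochner_integral_simplex[OF n] integral_weight[OF n])
  have "integral\<^sup>L ?P g \<le> integral\<^sup>L ?P ?h"
  proof (rule integral_mono_AE)
    show "integrable ?P g" "integrable ?P ?h"
      using g(1) h by (simp_all add: has_bochner_integral_iff)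
    show "AE x in ?P. g x \<le> ?h x"
      using g(2)
    proof eventually_elim
      case (elim x)
      show ?case
      proof (cases "x \<in> ?D")
        case True
        then have "?W x \<in> simplex_weights n"
          by (simp add: simplex_coords_def)
        from le[OF this] True show ?thesis
          by (simp add: elim)
      qed (simp add: elim)
    qed
  qed
  then have "\<phi> I \<le> 1 / fact (n - 1) * c + 1 / fact n * (\<Sum>i=1..n. b i)"
    using g(1) h by (simp add: has_bochner_integral_integral_eq sum_distrib_left)
  then have "fact (n - 1) * \<phi> I \<le> fact (n - 1) * (1 / fact (n - 1) * c + 1 / fact n * (\<Sum>i=1..n. b i))"
    by (rule mult_left_mono) simp
  also have "\<dots> = c + (\<Sum>i=1..n. b i) / real n"
    using n by (simp add: fact_reduce[of n] field_simps)
  finally show ?thesis .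
qed

lemma log_mean_has_bochner_int:
  assumes "log_mean_exists n M A"
  obtains I where "has_bochner_int (simplex_measure n) (\<lambda>\<omega>. M \<omega> A) I"
    "log_mean n M A = fact (n - 1) *\<^sub>R I"
  using assms bochner_integral_eq unfolding log_mean_exists_def log_mean_def bochner_integrable_def
  by blast

section \<open>Invariance of the mean under permutations\<close>

lemma permute_tuple_pos_tuples:
  assumes "\<pi> permutes {1..n}" "A \<in> pos_tuples n"
  shows "permute_tuple n \<pi> A \<in> pos_tuples n"
  using assms permutes_in_image[OF assms(1)] by (auto simp: pos_tuples_def permute_tuple_def)

text \<open>Permutations act on tuples from the right, which fixes the order of composition. Since
  \<open>\<sigma>\<close> preserves \<open>{1..n}\<close>, the inner tuple is read only where it is
  defined.\<close>

lemma permute_tuple_comp: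
  assumes "\<sigma> permutes {1..n}"
  shows "permute_tuple n \<sigma> (permute_tuple n \<pi> v) = permute_tuple n (\<pi> \<circ> \<sigma>) v"
proof
  fix i
  show "permute_tuple n \<sigma> (permute_tuple n \<pi> v) i = permute_tuple n (\<pi> \<circ> \<sigma>) v i"
    using permutes_in_image[OF assms, of i] by (cases "i \<in> {1..n}") (auto simp: permute_tuple_def)
qed

lemma permute_tuple_id:
  assumes "v \<in> extensional {1..n}"
  shows "permute_tuple n id v = v"
  using assms by (simp add: permute_tuple_def extensional_restrict)

lemma permute_tuple_transpose_transpose:
  assumes "a \<in> {1..n}" "b \<in> {1..n}" "v \<in> extensional {1..n}"
  shows "permute_tuple n (Transposition.transpose a b) (permute_tuple n (Transposition.transpose a b) v) = v"
  using assms by (simp add: permute_tuple_comp permutes_swap_id permute_tuple_id)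

text \<open>By joint symmetry, transposing the operators amounts to transposing the weights, which
  in coordinates is the measure preserving map \<open>swap_last_coord n a\<close>.\<close>

lemma log_mean_permute_swap_last:
  fixes M :: "(nat \<Rightarrow> real) \<Rightarrow> (nat \<Rightarrow> 'a bop) \<Rightarrow> 'a::chilbert_space bop"
  assumes a: "a \<in> {1..<n}" and A: "A \<in> pos_tuples n"
    and sym: "\<And>\<omega> A \<pi>. \<omega> \<in> simplex_weights n \<Longrightarrow> A \<in> pos_tuples n \<Longrightarrow> \<pi> permutes {1..n} \<Longrightarrow>
        M (permute_tuple n \<pi> \<omega>) (permute_tuple n \<pi> A) = M \<omega> A"
    and ex: "\<And>A. A \<in> pos_tuples n \<Longrightarrow> log_mean_exists n M A"
  shows "log_mean n M (permute_tuple n (Transposition.transpose a n) A) = log_mean n M A"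
proof -
  let ?\<tau> = "Transposition.transpose a n" and ?P = "coords_measure n" and ?D = "simplex_coords n"
    and ?W = "weights_of_coords n" and ?r = "swap_last_coord n a"
  have n1: "1 \<le> n" and a': "a \<in> {1..n}" "n \<in> {1..n}" using a by auto
  have \<tau>: "?\<tau> permutes {1..n}"
    using a' by (intro permutes_swap_id)
  obtain I where I: "has_bochner_int (simplex_measure n) (\<lambda>\<omega>. M \<omega> A) I"
      "log_mean n M A = fact (n - 1) *\<^sub>R I"
    by (rule log_mean_has_bochner_int[OF ex[OF A]])
  obtain J where J: "has_bochner_int (simplex_measure n) (\<lambda>\<omega>. M \<omega> (permute_tuple n ?\<tau> A)) J"
      "log_mean n M (permute_tuple n ?\<tau> A) = fact (n - 1) *\<^sub>R J"
    by (rule log_mean_has_bochner_int[OF ex[OF permute_tuple_pos_tuples[OF \<tau> A]]])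
  have M_swap: "M (?W x) (permute_tuple n ?\<tau> A) = M (?W (?r x)) A" if x: "x \<in> ?D" for x
  proof -
    have sp: "x \<in> space ?P" and w: "?W x \<in> simplex_weights n"
      using x by (simp_all add: simplex_coords_def space_coords_measure)
    \<comment> \<open>Writing the weights as a double transposition puts the same permutation on
      both arguments, so that \<open>sym\<close> cancels it.\<close>
    have "?W x = permute_tuple n ?\<tau> (permute_tuple n ?\<tau> (?W x))"
      using a' w by (simp add: permute_tuple_transpose_transpose simplex_weights_def PiE_iff)
    then have "M (?W x) (permute_tuple n ?\<tau> A)
        = M (permute_tuple n ?\<tau> (permute_tuple n ?\<tau> (?W x))) (permute_tuple n ?\<tau> A)"
      by simp
    also have "\<dots> = M (permute_tuple n ?\<tau> (?W x)) A"
      by (rule sym[OF permute_tuple_simplex_weights[OF \<tau> w] A \<tau>])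
    also have "permute_tuple n ?\<tau> (?W x) = ?W (?r x)"
      by (rule weights_swap_last_coord[OF a sp, symmetric])
    finally show ?thesis .
  qed
  have "I = J"
  proof (rule bop_eq_if_functionals_eq)
    fix \<phi> :: "'a bop \<Rightarrow> real"
    assume \<phi>: "bounded_linear \<phi>"
    obtain g where g: "has_bochner_integral ?P g (\<phi> I)"
        "AE x in ?P. g x = indicator ?D x * \<phi> (M (?W x) A)"
      by (rule has_bochner_int_simplex_functional[OF n1 I(1) \<phi>])
    obtain h where h: "has_bochner_integral ?P h (\<phi> J)"
        "AE x in ?P. h x = indicator ?D x * \<phi> (M (?W x) (permute_tuple n ?\<tau> A))"
      by (rule has_bochner_int_simplex_functional[OF n1 J(1) \<phi>])
    note r = swap_last_coord_measurable[OF a]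
    have meas: "g \<in> borel_measurable ?P" "h \<in> borel_measurable ?P"
      using g(1) h(1) by (auto dest: borel_measurable_has_bochner_integral)
    have "AE x in distr ?P ?P ?r. g x = indicator ?D x * \<phi> (M (?W x) A)"
      using g(2) by (simp only: distr_swap_last_coord[OF a])
    then have "AE x in ?P. g (?r x) = indicator ?D (?r x) * \<phi> (M (?W (?r x)) A)"
      by (rule AE_distrD[OF r])
    with h(2) AE_space have "AE x in ?P. g (?r x) = h x"
    proof eventually_elim
      case (elim x)
      then show ?case
        by (cases "x \<in> ?D") (simp_all add: swap_last_coord_simplex_iff[OF a] M_swap)
    qed
    then have "(\<integral>x. g (?r x) \<partial>?P) = integral\<^sup>L ?P h"
      using meas r by (intro integral_cong_AE measurable_compose[OF r]) auto
    moreover have "(\<integral>x. g (?r x) \<partial>?P) = integral\<^sup>L ?P g"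
      using integral_distr[OF r meas(1)] by (simp add: distr_swap_last_coord[OF a])
    ultimately show "\<phi> I = \<phi> J"
      using g(1) h(1) by (simp add: has_bochner_integral_integral_eq)
  qed
  with I(2) J(2) show ?thesis by simp
qed

text \<open>Conjugating the transposition of \<open>b\<close> and \<open>c\<close> by that of
  \<open>a\<close> and \<open>c\<close> relabels \<open>c\<close> as \<open>a\<close>. With
  \<open>c = n\<close> only swaps with the last index remain.\<close>

lemma transpose_via_last:
  assumes "a \<noteq> c" "b \<noteq> c" "a \<noteq> b"
  shows "Transposition.transpose a b
    = Transposition.transpose a c \<circ> (Transposition.transpose b c \<circ> Transposition.transpose a c)"
  using assms by (auto simp: fun_eq_iff Transposition.transpose_def)

lemma log_mean_permute:
  fixes M :: "(nat \<Rightarrow> real) \<Rightarrow> (nat \<Rightarrow> 'a bop) \<Rightarrow> 'a::chilbert_space bop"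
  assumes \<pi>: "\<pi> permutes {1..n}" and A: "A \<in> pos_tuples n"
    and sym: "\<And>\<omega> A \<pi>. \<omega> \<in> simplex_weights n \<Longrightarrow> A \<in> pos_tuples n \<Longrightarrow> \<pi> permutes {1..n} \<Longrightarrow>
        M (permute_tuple n \<pi> \<omega>) (permute_tuple n \<pi> A) = M \<omega> A"
    and ex: "\<And>A. A \<in> pos_tuples n \<Longrightarrow> log_mean_exists n M A"
  shows "log_mean n M (permute_tuple n \<pi> A) = log_mean n M A"
proof -
  note pos = permute_tuple_pos_tuples
  have perm: "Transposition.transpose a b permutes {1..n}" if "a \<in> {1..n}" "b \<in> {1..n}" for a b
    using that by (rule permutes_swap_id)
  have last: "log_mean n M (permute_tuple n (Transposition.transpose a n) B) = log_mean n M B"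
    if "a \<in> {1..<n}" "B \<in> pos_tuples n" for a B
    by (rule log_mean_permute_swap_last[OF that sym ex])
  have transp: "log_mean n M (permute_tuple n (Transposition.transpose a b) B) = log_mean n M B"
    if ab: "a \<in> {1..n}" "b \<in> {1..n}" "a \<noteq> b" and B: "B \<in> pos_tuples n" for a b B
  proof -
    consider "b = n" | "a = n" | "a \<noteq> n" "b \<noteq> n" by blast
    then show ?thesis
    proof cases
      case 1
      then show ?thesis
        using ab B last[of a B] by simp
    next
      case 2
      then show ?thesis
        using ab B last[of b B] by (simp add: transpose_commute)
    next
      case 3
      then have ab': "a \<in> {1..<n}" "b \<in> {1..<n}" "n \<in> {1..n}" using ab by auto
      let ?\<sigma> = "Transposition.transpose a n" and ?\<tau> = "Transposition.transpose b n"
      have \<sigma>: "?\<sigma> permutes {1..n}" and \<tau>: "?\<tau> permutes {1..n}"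
        using perm[OF ab(1) ab'(3)] perm[OF ab(2) ab'(3)] .
      have "permute_tuple n (Transposition.transpose a b) B
          = permute_tuple n ?\<sigma> (permute_tuple n ?\<tau> (permute_tuple n ?\<sigma> B))"
        using 3 ab by (simp add: permute_tuple_comp[OF \<tau>] permute_tuple_comp[OF \<sigma>]
            transpose_via_last[of a n b] comp_assoc)
      then show ?thesis
        using ab' B \<sigma> \<tau> by (simp add: last pos)
    qed
  qed
  have "finite {1..n}" by simp
  \<comment> \<open>The claim is quantified over all tuples because the induction hypothesis for
    \<open>p\<close> is applied to an already transposed one.\<close>
  from \<pi> this have "\<forall>A \<in> pos_tuples n. log_mean n M (permute_tuple n \<pi> A) = log_mean n M A"
  proof (induction rule: permutes_induct)
    case id
    have "permute_tuple n id A = A" if "A \<in> pos_tuples n" for A :: "nat \<Rightarrow> 'a bop"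
      using that by (intro permute_tuple_id) (simp add: pos_tuples_def PiE_def)
    then show ?case by (simp add: id_def)
  next
    case (swap a b p)
    show ?case
    proof
      fix A :: "nat \<Rightarrow> 'a bop"
      assume A: "A \<in> pos_tuples n"
      have "permute_tuple n (Transposition.transpose a b) A \<in> pos_tuples n"
        by (rule pos[OF perm[OF swap(1,2)] A])
      moreover have "permute_tuple n (Transposition.transpose a b \<circ> p) A
          = permute_tuple n p (permute_tuple n (Transposition.transpose a b) A)"
        by (rule permute_tuple_comp[OF swap(4), symmetric])
      ultimately show "log_mean n M (permute_tuple n (Transposition.transpose a b \<circ> p) A)
          = log_mean n M A"
        using swap(5) transp[OF swap(1,2,3) A] by simp
    qed
  qed
  with A show ?thesis by blast
qed

section \<open>Congruence and order for the mean\<close>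

lemma log_mean_transform:
  fixes M :: "(nat \<Rightarrow> real) \<Rightarrow> (nat \<Rightarrow> 'a bop) \<Rightarrow> 'a::chilbert_space bop"
  assumes h: "bounded_linear h" and ex: "log_mean_exists n M A"
    and eq: "\<And>\<omega>. \<omega> \<in> simplex_weights n \<Longrightarrow> M \<omega> B = h (M \<omega> A)"
  shows "log_mean n M B = h (log_mean n M A)"
proof -
  obtain I where I: "has_bochner_int (simplex_measure n) (\<lambda>\<omega>. M \<omega> A) I"
      "log_mean n M A = fact (n - 1) *\<^sub>R I"
    by (rule log_mean_has_bochner_int[OF ex])
  have "has_bochner_int (simplex_measure n) (\<lambda>\<omega>. M \<omega> B) (h I)"
    using has_bochner_int_bounded_linear[OF I(1) h] space_simplex_measure[of n] eq
    by (subst has_bochner_int_cong[where g = "\<lambda>\<omega>. h (M \<omega> A)"]) auto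
  then show ?thesis
    unfolding log_mean_def[of n M B] I(2)
    by (simp add: bochner_integral_eq linear_scale[OF bounded_linear.linear[OF h]])
qed

lemma log_mean_functional_le:
  fixes M :: "(nat \<Rightarrow> real) \<Rightarrow> (nat \<Rightarrow> 'a bop) \<Rightarrow> 'a::chilbert_space bop"
  assumes n: "2 \<le> n" and ex: "log_mean_exists n M A" and \<phi>: "bounded_linear \<phi>"
    and le: "\<And>\<omega>. \<omega> \<in> simplex_weights n \<Longrightarrow> \<phi> (M \<omega> A) \<le> c + (\<Sum>i=1..n. \<omega> i * b i)"
  shows "\<phi> (log_mean n M A) \<le> c + (\<Sum>i=1..n. b i) / real n"
proof -
  obtain I where I: "has_bochner_int (simplex_measure n) (\<lambda>\<omega>. M \<omega> A) I"
      "log_mean n M A = fact (n - 1) *\<^sub>R I"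
    by (rule log_mean_has_bochner_int[OF ex])
  show ?thesis
    using simplex_integral_functional_le[OF n I(1) \<phi> le] I(2)
    by (simp add: linear_scale[OF bounded_linear.linear[OF \<phi>]])
qed

text \<open>Once both quadratic forms are known to be real, only the comparison of their values
  remains.\<close>

lemma bop_leI:
  assumes "\<And>x. inner ((- \<i>) *\<^sub>C bop_apply S x) x = 0" "\<And>x. inner ((- \<i>) *\<^sub>C bop_apply T x) x = 0"
    and "\<And>x. inner (bop_apply S x) x \<le> inner (bop_apply T x) x"
  shows "S \<preceq> T"
  using assms
  by (simp add: bop_le_def bop_psd_iff_functionals bop_apply_diff scaleC_diff_right inner_diff_left)

lemma bop_le_inner: "S \<preceq> T \<Longrightarrow> inner (bop_apply S x) x \<le> inner (bop_apply T x) x"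
  using bop_psd_nonneg[of "T - S" x] by (simp add: bop_le_def bop_apply_diff inner_diff_left)

theorem proposition7:
  fixes n :: nat
    and M :: "(nat \<Rightarrow> real) \<Rightarrow> (nat \<Rightarrow> 'a bop) \<Rightarrow> 'a::chilbert_space bop"
  assumes n: "2 \<le> n"
    and M_pos: "\<And>\<omega> A. \<omega> \<in> simplex_weights n \<Longrightarrow> A \<in> pos_tuples n \<Longrightarrow> M \<omega> A \<in> bop_pos"
    and P3: "\<And>\<omega> A \<pi>. \<omega> \<in> simplex_weights n \<Longrightarrow> A \<in> pos_tuples n \<Longrightarrow> \<pi> permutes {1..n} \<Longrightarrow>
        M (permute_tuple n \<pi> \<omega>) (permute_tuple n \<pi> A) = M \<omega> A"
    and P7: "\<And>\<omega> A X. \<omega> \<in> simplex_weights n \<Longrightarrow> A \<in> pos_tuples n \<Longrightarrow> bop_invertible X \<Longrightarrow>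
        M \<omega> (\<lambda>i\<in>{1..n}. bop_adj X * A i * X) = bop_adj X * M \<omega> A * X"
    and P8: "\<And>\<omega> A. \<omega> \<in> simplex_weights n \<Longrightarrow> A \<in> pos_tuples n \<Longrightarrow>
        bop_inv (M \<omega> (\<lambda>i\<in>{1..n}. bop_inv (A i))) = M \<omega> A"
    and P10: "\<And>\<omega> A. \<omega> \<in> simplex_weights n \<Longrightarrow> A \<in> pos_tuples n \<Longrightarrow>
        bop_inv (\<Sum>i=1..n. \<omega> i *\<^sub>R bop_inv (A i)) \<preceq> M \<omega> A \<and>
        M \<omega> A \<preceq> (\<Sum>i=1..n. \<omega> i *\<^sub>R A i)"
    and log_mean_ex: "\<And>A. A \<in> pos_tuples n \<Longrightarrow> log_mean_exists n M A"
  shows "\<forall>A \<in> pos_tuples n.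
      (\<forall>\<pi>. \<pi> permutes {1..n} \<longrightarrow> log_mean n M (permute_tuple n \<pi> A) = log_mean n M A) \<and>
      (\<forall>X. bop_invertible X \<longrightarrow>
        log_mean n M (\<lambda>i\<in>{1..n}. bop_adj X * A i * X) = bop_adj X * log_mean n M A * X) \<and>
      harm_mean n A \<preceq> log_mean n M A \<and> log_mean n M A \<preceq> arith_mean n A"
proof (intro ballI conjI allI impI)
  fix A :: "nat \<Rightarrow> 'a bop"
  assume A: "A \<in> pos_tuples n"
  have A_pos: "A i \<in> bop_pos" if "i \<in> {1..n}" for i
    using A that by (auto simp: pos_tuples_def)
  have w_pos: "0 < \<omega> i" if "\<omega> \<in> simplex_weights n" "i \<in> {1..n}" for \<omega> i
    using that by (auto simp: simplex_weights_def PiE_iff)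
  have ne: "finite {1..n}" "{1..n} \<noteq> {}"
    using n by auto
  show "log_mean n M (permute_tuple n \<pi> A) = log_mean n M A" if "\<pi> permutes {1..n}" for \<pi>
    by (rule log_mean_permute[OF that A P3 log_mean_ex])
  show "log_mean n M (\<lambda>i\<in>{1..n}. bop_adj X * A i * X) = bop_adj X * log_mean n M A * X"
    if X: "bop_invertible X" for X
  proof (rule log_mean_transform[OF _ log_mean_ex[OF A]])
    show "bounded_linear (\<lambda>T. bop_adj X * T * X)"
      by (intro bounded_linear_compose[OF bounded_linear_mult_left] bounded_linear_mult_right)
    show "M \<omega> (\<lambda>i\<in>{1..n}. bop_adj X * A i * X) = bop_adj X * M \<omega> A * X"
      if "\<omega> \<in> simplex_weights n" for \<omega>
      by (rule P7[OF that A X])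
  qed
  note le = log_mean_functional_le[OF n log_mean_ex[OF A]]
  let ?L = "log_mean n M A"
  \<comment> \<open>The imaginary part of the form vanishes on every \<open>M \<omega> A\<close>.
    The integral bound with zero constants, applied to this functional and to its negative, carries
    this over to \<open>?L\<close>.\<close>
  have L_real: "inner ((- \<i>) *\<^sub>C bop_apply ?L x) x = 0" for x
  proof -
    let ?\<psi> = "\<lambda>T. inner ((- \<i>) *\<^sub>C bop_apply T x) x"
    have zero: "?\<psi> (M \<omega> A) = 0" if "\<omega> \<in> simplex_weights n" for \<omega>
      using M_pos[OF that A] unfolding bop_pos_def bop_psd_iff_functionals by blast
    have "?\<psi> ?L \<le> 0 + (\<Sum>i=1..n. 0) / real n"
      by (rule le[OF bounded_linear_bop_form]) (simp only: zero, simp)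
    moreover have "- ?\<psi> ?L \<le> 0 + (\<Sum>i=1..n. 0) / real n"
      by (rule le[OF bounded_linear_minus[OF bounded_linear_bop_form]]) (simp only: zero, simp)
    ultimately show ?thesis by simp
  qed
  have mean_pos: "(1 / real n) *\<^sub>R (\<Sum>i=1..n. B i) \<in> bop_pos"
    if "\<And>i. i \<in> {1..n} \<Longrightarrow> B i \<in> bop_pos" for B :: "nat \<Rightarrow> 'a bop"
    using bop_pos_weighted_sum[OF ne, of "\<lambda>_. 1 / real n" B] that n
    by (simp add: scaleR_sum_right)
  have pos_real: "inner ((- \<i>) *\<^sub>C bop_apply T x) x = 0" if "T \<in> bop_pos" for T :: "'a bop" and x
    using that unfolding bop_pos_def bop_psd_iff_functionals by blast
  have weighted_form: "inner (bop_apply (\<Sum>i=1..n. w i *\<^sub>R B i) x) y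
      = (\<Sum>i=1..n. w i * inner (bop_apply (B i) x) y)" for w and B :: "nat \<Rightarrow> 'a bop" and x y
    by (simp add: linear_sum[OF bounded_linear.linear[OF bounded_linear_bop_inner]]
        bop_apply_scaleR)
  have mean_form: "inner (bop_apply ((1 / real n) *\<^sub>R (\<Sum>i=1..n. B i)) x) y
      = (\<Sum>i=1..n. inner (bop_apply (B i) x) y) / real n" for B :: "nat \<Rightarrow> 'a bop" and x y
    by (simp add: bop_apply_scaleR linear_sum[OF bounded_linear.linear[OF bounded_linear_bop_inner]])
  show "?L \<preceq> arith_mean n A"
  proof (rule bop_leI[OF L_real])
    show "inner ((- \<i>) *\<^sub>C bop_apply (arith_mean n A) x) x = 0" for x
      unfolding arith_mean_def by (rule pos_real[OF mean_pos[OF A_pos]])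
    fix x
    have "inner (bop_apply ?L x) x \<le> 0 + (\<Sum>i=1..n. inner (bop_apply (A i) x) x) / real n"
    proof (rule le[OF bounded_linear_bop_inner])
      fix \<omega> assume \<omega>: "\<omega> \<in> simplex_weights n"
      show "inner (bop_apply (M \<omega> A) x) x \<le> 0 + (\<Sum>i=1..n. \<omega> i * inner (bop_apply (A i) x) x)"
        using bop_le_inner[OF conjunct2[OF P10[OF \<omega> A]], of x] by (simp only: weighted_form add_0)
    qed
    then show "inner (bop_apply ?L x) x \<le> inner (bop_apply (arith_mean n A) x) x"
      unfolding arith_mean_def mean_form by simp
  qed
  show "harm_mean n A \<preceq> ?L"
  proof (rule bop_leI[OF _ L_real])
    let ?B = "\<lambda>i. bop_inv (A i)" and ?H = "harm_mean n A"
    let ?S = "(1 / real n) *\<^sub>R (\<Sum>i=1..n. ?B i)"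
    have B_pos: "?B i \<in> bop_pos" if "i \<in> {1..n}" for i
      by (rule bop_inv_pos[OF A_pos[OF that]])
    have S: "?S \<in> bop_pos"
      by (rule mean_pos[OF B_pos])
    show "inner ((- \<i>) *\<^sub>C bop_apply ?H x) x = 0" for x
      unfolding harm_mean_def by (rule pos_real[OF bop_inv_pos[OF S]])
    fix x
    \<comment> \<open>This vector does not depend on \<open>\<omega>\<close>, so the lower bound for
      the form stays affine in the weights.\<close>
    let ?y = "bop_apply ?H x"
    have "bop_apply ?S ?y = x"
      using S unfolding harm_mean_def by (intro bop_apply_inv) (simp add: bop_pos_def)
    \<comment> \<open>As \<open>?H\<close> inverts \<open>?S\<close>, the averaged quadratic term
      equals \<open>inner x ?y\<close> and cancels half of the linear term
      \<open>2 * inner x ?y\<close>.\<close>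
    then have Sy: "(\<Sum>i=1..n. inner (bop_apply (?B i) ?y) ?y) / real n = inner x ?y"
      using mean_form[of ?B ?y ?y] by simp
    \<comment> \<open>The integral estimate gives upper bounds, so it is applied to the negated
      form, with constant \<open>- 2 * inner x ?y\<close>.\<close>
    have "- inner (bop_apply ?L x) x
        \<le> - 2 * inner x ?y + (\<Sum>i=1..n. inner (bop_apply (?B i) ?y) ?y) / real n"
    proof (rule le[OF bounded_linear_minus[OF bounded_linear_bop_inner]])
      fix \<omega> assume \<omega>: "\<omega> \<in> simplex_weights n"
      have "(\<Sum>i=1..n. \<omega> i *\<^sub>R ?B i) \<in> bop_pos"
        using w_pos[OF \<omega>] B_pos by (intro bop_pos_weighted_sum[OF ne])
      \<comment> \<open>The variational bound replaces the inverse of the weighted sum by an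
        expression affine in \<open>\<omega>\<close>; the lower half of \<open>P10\<close> then
        passes to \<open>M \<omega> A\<close>.\<close>
      from bop_inv_inner_ge[OF this, of x ?y]
      have "2 * inner x ?y - (\<Sum>i=1..n. \<omega> i * inner (bop_apply (?B i) ?y) ?y)
          \<le> inner (bop_apply (bop_inv (\<Sum>i=1..n. \<omega> i *\<^sub>R ?B i)) x) x"
        by (simp only: weighted_form)
      also have "\<dots> \<le> inner (bop_apply (M \<omega> A) x) x"
        by (rule bop_le_inner[OF conjunct1[OF P10[OF \<omega> A]]])
      finally show "- inner (bop_apply (M \<omega> A) x) x
          \<le> - 2 * inner x ?y + (\<Sum>i=1..n. \<omega> i * inner (bop_apply (?B i) ?y) ?y)"
        by simp
    qed
    then show "inner ?y x \<le> inner (bop_apply ?L x) x"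
      unfolding Sy inner_commute[of ?y x] by simp
  qed
qed

end
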